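(* Let $V$ be a vector space over $\mathbb{K}$, $f\in V^*$ a linear form and $\lambda\in\mathbb{K}$. Give the symmetric algebra $S(V)$ the bilinear product $\bullet$ defined by \begin{align*} &\forall x\in S(V), & 1\bullet x&=0,\\ &\forall x,x_1,\ldots,x_k\in V, & x\bullet x_1\ldots x_k&=\sum_{I\subsetneq [k]} |I|!\,\lambda^{|I|} f(x)\prod_{i\in I}f(x_i)\prod_{i\notin I}x_i,\\ &\forall x_1,\ldots,x_k\in V,\ \forall x\in S(V), & x_1\ldots x_k\bullet x&=\sum_{i=1}^k x_1\ldots (x_i\bullet x)\ldots x_k . \end{align*} Then $(S(V),m,\bullet,\Delta)$ is a Com-PreLie bialgebra (denoted $S(V,f,\lambda)$).
   Context: $\mathbb{K}$ is a field of characteristic zero. $[k]=\{1,\ldots,k\}$; the sum over $I\subsetneq[k]$ runs over proper subsets of $[k]$ (so it is empty for $k=0$, i.e. $x\bullet 1=0$), and $\lambda^0=1$. $S(V)$ is the symmetric algebra with its usual product $m$ and the coproduct $\Delta$ given by the algebra morphism with $\Delta(v)=v\otimes 1+1\otimes v$ for $v\in V$. A Com-PreLie algebra is a vector space $A$ with bilinear products $\cdot,\bullet$ such that $\cdot$ is commutative and associative and, for all $a,b,c\in A$, $(a\bullet b)\bullet c-a\bullet(b\bullet c)=(a\bullet c)\bullet b-a\bullet(c\bullet b)$ (pre-Lie identity) and $(a\cdot b)\bullet c=(a\bullet c)\cdot b+a\cdot(b\bullet c)$ (Leibniz identity). It is unitary if $\cdot$ has a unit $1$. A Com-PreLie bialgebra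 is a family $(A,\cdot,\bullet,\Delta)$ such that $(A,\cdot,\bullet)$ is a unitary Com-PreLie algebra, $(A,\cdot,\Delta)$ is a bialgebra, and for all $a,b\in A$, $\Delta(a\bullet b)=a^{(1)}\otimes a^{(2)}\bullet b+a^{(1)}\bullet b^{(1)}\otimes a^{(2)}\cdot b^{(2)}$, in Sweedler's notation $\Delta(x)=x^{(1)}\otimes x^{(2)}$. *)

theory Defs
  imports
    "HOL-Algebra.Algebraic_Closure_Type"
    "HOL-Library.Poly_Mapping"
    "HOL-Library.Multiset"
begin

text \<open>
  The base field is a type \<open>'k\<close>, viewed as the ring \<open>ring_of_type_algebra\<close>. A commutative
  \<open>'k\<close>-algebra with unit is a record \<open>A\<close> such that \<open>algebra ring_of_type_algebra A\<close>.
\<close>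

definition type_algebra :: "('k \<Rightarrow> 'r \<Rightarrow> 'r) \<Rightarrow> ('k, 'r::ring_1) module"
  where "type_algebra s = ring.extend ring_of_type_algebra (module.fields s)"

definition alg_hom :: "('k, 'a) module \<Rightarrow> ('k, 'b) module \<Rightarrow> ('a \<Rightarrow> 'b) set"
  where "alg_hom A B =
    {h \<in> ring_hom A B. \<forall>c. \<forall>x\<in>carrier A. h (c \<odot>\<^bsub>A\<^esub> x) = c \<odot>\<^bsub>B\<^esub> h x}"

definition bilinear_map ::
  "('k, 'a) module \<Rightarrow> ('k, 'b) module \<Rightarrow> ('k, 'c) module \<Rightarrow> ('a \<Rightarrow> 'b \<Rightarrow> 'c) \<Rightarrow> bool"
  where "bilinear_map A B C g \<longleftrightarrow>
    (\<forall>a\<in>carrier A. \<forall>b\<in>carrier B. g a b \<in> carrier C) \<and>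
    (\<forall>a\<in>carrier A. \<forall>a'\<in>carrier A. \<forall>b\<in>carrier B.
       g (a \<oplus>\<^bsub>A\<^esub> a') b = g a b \<oplus>\<^bsub>C\<^esub> g a' b) \<and>
    (\<forall>a\<in>carrier A. \<forall>b\<in>carrier B. \<forall>b'\<in>carrier B.
       g a (b \<oplus>\<^bsub>B\<^esub> b') = g a b \<oplus>\<^bsub>C\<^esub> g a b') \<and>
    (\<forall>c. \<forall>a\<in>carrier A. \<forall>b\<in>carrier B. g (c \<odot>\<^bsub>A\<^esub> a) b = c \<odot>\<^bsub>C\<^esub> g a b) \<and>
    (\<forall>c. \<forall>a\<in>carrier A. \<forall>b\<in>carrier B. g a (c \<odot>\<^bsub>B\<^esub> b) = c \<odot>\<^bsub>C\<^esub> g a b)"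

definition quotient_algebra :: "('k, 'a) module \<Rightarrow> 'a set \<Rightarrow> ('k, 'a set) module"
  where "quotient_algebra A I =
    ring.extend (A Quot I) (module.fields (\<lambda>c Y. \<Union>y\<in>Y. I +>\<^bsub>A\<^esub> (c \<odot>\<^bsub>A\<^esub> y)))"


section \<open>Tensor products\<close>

text \<open>
  The free vector space on the set \<open>carrier A \<times> carrier B\<close>, with the product of the basis
  elements taken componentwise.
\<close>

definition free_tensor :: "('k::field, 'a) module \<Rightarrow> ('k, 'b) module \<Rightarrow> ('k, 'a \<times> 'b \<Rightarrow>\<^sub>0 'k) module"
  where "free_tensor A B =
    \<lparr>carrier = {p. Poly_Mapping.keys p \<subseteq> carrier A \<times> carrier B},
     monoid.mult = (\<lambda>p q. \<Sum>x\<in>Poly_Mapping.keys p. \<Sum>y\<in>Poly_Mapping.keys q.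
       Poly_Mapping.single (fst x \<otimes>\<^bsub>A\<^esub> fst y, snd x \<otimes>\<^bsub>B\<^esub> snd y)
         (Poly_Mapping.lookup p x * Poly_Mapping.lookup q y)),
     one = Poly_Mapping.single (\<one>\<^bsub>A\<^esub>, \<one>\<^bsub>B\<^esub>) 1,
     ring.zero = 0,
     add = (+),
     module.smult = (\<lambda>c. Poly_Mapping.map ((*) c))\<rparr>"

definition tensor_relations ::
  "('k::field, 'a) module \<Rightarrow> ('k, 'b) module \<Rightarrow> ('a \<times> 'b \<Rightarrow>\<^sub>0 'k) set"
  where "tensor_relations A B =
    {Poly_Mapping.single (a \<oplus>\<^bsub>A\<^esub> a', b) 1 - Poly_Mapping.single (a, b) 1
       - Poly_Mapping.single (a', b) 1
       | a a' b. a \<in> carrier A \<and> a' \<in> carrier A \<and> b \<in> carrier B} \<union>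
    {Poly_Mapping.single (a, b \<oplus>\<^bsub>B\<^esub> b') 1 - Poly_Mapping.single (a, b) 1
       - Poly_Mapping.single (a, b') 1
       | a b b'. a \<in> carrier A \<and> b \<in> carrier B \<and> b' \<in> carrier B} \<union>
    {Poly_Mapping.single (c \<odot>\<^bsub>A\<^esub> a, b) 1 - Poly_Mapping.single (a, b) c
       | c a b. a \<in> carrier A \<and> b \<in> carrier B} \<union>
    {Poly_Mapping.single (a, c \<odot>\<^bsub>B\<^esub> b) 1 - Poly_Mapping.single (a, b) c
       | c a b. a \<in> carrier A \<and> b \<in> carrier B}"

definition tensor_kernel ::
  "('k::field, 'a) module \<Rightarrow> ('k, 'b) module \<Rightarrow> ('a \<times> 'b \<Rightarrow>\<^sub>0 'k) set"
  where "tensor_kernel A B =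
    Modules.module.span (\<lambda>c. Poly_Mapping.map ((*) c)) (tensor_relations A B)"

definition tensor ::
  "('k::field, 'a) module \<Rightarrow> ('k, 'b) module \<Rightarrow> ('k, ('a \<times> 'b \<Rightarrow>\<^sub>0 'k) set) module"
  where "tensor A B = quotient_algebra (free_tensor A B) (tensor_kernel A B)"

definition pure_tensor ::
  "('k::field, 'a) module \<Rightarrow> ('k, 'b) module \<Rightarrow> 'a \<Rightarrow> 'b \<Rightarrow> ('a \<times> 'b \<Rightarrow>\<^sub>0 'k) set"
  where "pure_tensor A B a b =
    tensor_kernel A B +>\<^bsub>free_tensor A B\<^esub> Poly_Mapping.single (a, b) 1"

text \<open>
  Sweedler's notation: for a bilinear map \<open>g\<close> from \<open>A \<times> B\<close> to \<open>C\<close> and \<open>t\<close> in the tensor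
  product of \<open>A\<close> and \<open>B\<close>, written as a sum of pure tensors \<open>t\<^sup>1 \<otimes> t\<^sup>2\<close>, the element
  \<open>sweedler C g t\<close> of \<open>C\<close> is \<open>g t\<^sup>1 t\<^sup>2\<close>. Since \<open>g\<close> is bilinear, this does not depend on the
  chosen representative of the class \<open>t\<close>.
\<close>

definition sweedler ::
  "('k::field, 'c) module \<Rightarrow> ('a \<Rightarrow> 'b \<Rightarrow> 'c) \<Rightarrow> ('a \<times> 'b \<Rightarrow>\<^sub>0 'k) set \<Rightarrow> 'c"
  where "sweedler C g t =
    (let p = (SOME p. p \<in> t) in
       \<Oplus>\<^bsub>C\<^esub>x\<in>Poly_Mapping.keys p. Poly_Mapping.lookup p x \<odot>\<^bsub>C\<^esub> g (fst x) (snd x))"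


section \<open>Com-PreLie bialgebras\<close>

text \<open>Since the record \<open>A\<close> carries a unit, this is the unitary notion.\<close>

definition com_prelie_algebra :: "('k::field, 'a) module \<Rightarrow> ('a \<Rightarrow> 'a \<Rightarrow> 'a) \<Rightarrow> bool"
  where "com_prelie_algebra A bul \<longleftrightarrow>
    algebra ring_of_type_algebra A \<and>
    bilinear_map A A A bul \<and>
    (\<forall>a\<in>carrier A. \<forall>b\<in>carrier A. \<forall>c\<in>carrier A.
       bul (bul a b) c \<ominus>\<^bsub>A\<^esub> bul a (bul b c) = bul (bul a c) b \<ominus>\<^bsub>A\<^esub> bul a (bul c b)) \<and>
    (\<forall>a\<in>carrier A. \<forall>b\<in>carrier A. \<forall>c\<in>carrier A.
       bul (a \<otimes>\<^bsub>A\<^esub> b) c = bul a c \<otimes>\<^bsub>A\<^esub> b \<oplus>\<^bsub>A\<^esub> a \<otimes>\<^bsub>A\<^esub> bul b c)"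

text \<open>
  Coassociativity is stated in \<open>A \<otimes> (A \<otimes> A)\<close>, with the canonical isomorphism from
  \<open>(A \<otimes> A) \<otimes> A\<close> built into the left-hand side.
\<close>

definition bialgebra ::
  "('k::field, 'a) module \<Rightarrow> ('a \<Rightarrow> ('a \<times> 'a \<Rightarrow>\<^sub>0 'k) set) \<Rightarrow> bool"
  where "bialgebra A Delta \<longleftrightarrow>
    algebra ring_of_type_algebra A \<and>
    Delta \<in> alg_hom A (tensor A A) \<and>
    (\<forall>x\<in>carrier A.
       sweedler (tensor A (tensor A A))
         (\<lambda>y z. sweedler (tensor A (tensor A A))
            (\<lambda>u v. pure_tensor A (tensor A A) u (pure_tensor A A v z)) (Delta y))
         (Delta x) =
       sweedler (tensor A (tensor A A))
         (\<lambda>y z. pure_tensor A (tensor A A) y (Delta z)) (Delta x)) \<and>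
    (\<exists>eps \<in> alg_hom A (type_algebra (*)). \<forall>x\<in>carrier A.
       sweedler A (\<lambda>y z. eps y \<odot>\<^bsub>A\<^esub> z) (Delta x) = x \<and>
       sweedler A (\<lambda>y z. eps z \<odot>\<^bsub>A\<^esub> y) (Delta x) = x)"

definition com_prelie_bialgebra ::
  "('k::field, 'a) module \<Rightarrow> ('a \<Rightarrow> 'a \<Rightarrow> 'a) \<Rightarrow> ('a \<Rightarrow> ('a \<times> 'a \<Rightarrow>\<^sub>0 'k) set) \<Rightarrow> bool"
  where "com_prelie_bialgebra A bul Delta \<longleftrightarrow>
    com_prelie_algebra A bul \<and>
    bialgebra A Delta \<and>
    (\<forall>a\<in>carrier A. \<forall>b\<in>carrier A.
       Delta (bul a b) =
         sweedler (tensor A A) (\<lambda>a1 a2. pure_tensor A A a1 (bul a2 b)) (Delta a)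
         \<oplus>\<^bsub>tensor A A\<^esub>
         sweedler (tensor A A)
           (\<lambda>a1 a2. sweedler (tensor A A)
              (\<lambda>b1 b2. pure_tensor A A (bul a1 b1) (a2 \<otimes>\<^bsub>A\<^esub> b2)) (Delta b))
           (Delta a))"


section \<open>The symmetric algebra of a vector space\<close>

text \<open>
  The vector space is the type \<open>'v\<close> with scalar multiplication \<open>scale\<close>. Its symmetric algebra is
  the polynomial algebra with one indeterminate \<open>X v\<close> for each vector \<open>v\<close> (monomials being
  multisets of vectors), modulo the ideal generated by \<open>X (v + w) - X v - X w\<close> and
  \<open>X (c v) - c X v\<close>.
\<close>

definition free_comm_algebra :: "('k::field, 'v multiset \<Rightarrow>\<^sub>0 'k) module"
  where "free_comm_algebra = type_algebra (\<lambda>c p. Poly_Mapping.single {#} c * p)"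

definition sym_ideal :: "('k::field \<Rightarrow> 'v::ab_group_add \<Rightarrow> 'v) \<Rightarrow> ('v multiset \<Rightarrow>\<^sub>0 'k) set"
  where "sym_ideal scale =
    genideal (free_comm_algebra :: ('k, 'v multiset \<Rightarrow>\<^sub>0 'k) module)
      ({Poly_Mapping.single {#v + w#} 1 - Poly_Mapping.single {#v#} 1
          - Poly_Mapping.single {#w#} 1 | v w. True} \<union>
       {Poly_Mapping.single {#scale c v#} 1 - Poly_Mapping.single {#v#} c | c v. True})"

definition sym_alg ::
  "('k::field \<Rightarrow> 'v::ab_group_add \<Rightarrow> 'v) \<Rightarrow> ('k, ('v multiset \<Rightarrow>\<^sub>0 'k) set) module"
  where "sym_alg scale = quotient_algebra free_comm_algebra (sym_ideal scale)"

definition sym_incl ::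
  "('k::field \<Rightarrow> 'v::ab_group_add \<Rightarrow> 'v) \<Rightarrow> 'v \<Rightarrow> ('v multiset \<Rightarrow>\<^sub>0 'k) set"
  where "sym_incl scale v =
    sym_ideal scale
      +>\<^bsub>(free_comm_algebra :: ('k, 'v multiset \<Rightarrow>\<^sub>0 'k) module)\<^esub> Poly_Mapping.single {#v#} 1"

definition sym_coproduct ::
  "('k::field \<Rightarrow> 'v::ab_group_add \<Rightarrow> 'v) \<Rightarrow>
   (('v multiset \<Rightarrow>\<^sub>0 'k) set \<Rightarrow>
    (('v multiset \<Rightarrow>\<^sub>0 'k) set \<times> ('v multiset \<Rightarrow>\<^sub>0 'k) set \<Rightarrow>\<^sub>0 'k) set) \<Rightarrow> bool"
  where "sym_coproduct scale Delta \<longleftrightarrow>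
    (let S = sym_alg scale; \<iota> = sym_incl scale in
     Delta \<in> alg_hom S (tensor S S) \<and>
     (\<forall>v. Delta (\<iota> v) =
        pure_tensor S S (\<iota> v) \<one>\<^bsub>S\<^esub> \<oplus>\<^bsub>tensor S S\<^esub> pure_tensor S S \<one>\<^bsub>S\<^esub> (\<iota> v)))"

definition sym_bullet ::
  "('k::field \<Rightarrow> 'v::ab_group_add \<Rightarrow> 'v) \<Rightarrow> ('v \<Rightarrow> 'k) \<Rightarrow> 'k \<Rightarrow>
   (('v multiset \<Rightarrow>\<^sub>0 'k) set \<Rightarrow> ('v multiset \<Rightarrow>\<^sub>0 'k) set \<Rightarrow> ('v multiset \<Rightarrow>\<^sub>0 'k) set) \<Rightarrow> bool"
  where "sym_bullet scale f lam bul \<longleftrightarrow>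
    (let S = sym_alg scale; \<iota> = sym_incl scale in
     bilinear_map S S S bul \<and>
     (\<forall>x\<in>carrier S. bul \<one>\<^bsub>S\<^esub> x = \<zero>\<^bsub>S\<^esub>) \<and>
     (\<forall>x. \<forall>k::nat. \<forall>xs :: nat \<Rightarrow> 'v.
        bul (\<iota> x) (\<Otimes>\<^bsub>S\<^esub>i\<in>{1..k}. \<iota> (xs i)) =
          (\<Oplus>\<^bsub>S\<^esub>I\<in>{I. I \<subset> {1..k}}.
             (of_nat (fact (card I)) * lam ^ card I * f x * (\<Prod>i\<in>I. f (xs i)))
               \<odot>\<^bsub>S\<^esub> (\<Otimes>\<^bsub>S\<^esub>i\<in>{1..k} - I. \<iota> (xs i)))) \<and>
     (\<forall>k::nat. \<forall>xs :: nat \<Rightarrow> 'v. \<forall>x\<in>carrier S.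
        bul (\<Otimes>\<^bsub>S\<^esub>i\<in>{1..k}. \<iota> (xs i)) x =
          (\<Oplus>\<^bsub>S\<^esub>i\<in>{1..k}. \<Otimes>\<^bsub>S\<^esub>j\<in>{1..k}. if j = i then bul (\<iota> (xs j)) x else \<iota> (xs j))))"

end

theory Submission
  imports Defs "HOL-Library.Product_Plus"
begin

text \<open>
  The product has a closed form. Let \<open>d\<close> be the derivation of the symmetric algebra that extends
  \<open>f\<close>. It lowers the degree, so \<open>G = (\<Sum>n. \<lambda>\<^sup>n d\<^sup>n)\<close> is a locally finite sum, and it inverts
  \<open>1 - \<lambda> d\<close>. Since \<open>d\<^sup>n (x\<^sub>1 \<cdots> x\<^sub>k)\<close> collects every \<open>n\<close>-element set \<open>I\<close> with the factor \<open>n!\<close>,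
  \<open>G (x\<^sub>1 \<cdots> x\<^sub>k)\<close> is the sum in the definition of the product, extended to all subsets \<open>I\<close>; the
  subset \<open>I = [k]\<close> contributes the constant term. Hence \<open>x \<bullet> y = d x \<cdot> \<Phi> y\<close>, where \<open>\<Phi> y\<close> is \<open>G y\<close>
  without its constant term (\<open>resolvent_prod_gen\<close>, \<open>bullet_gen_prod\<close>, \<open>bullet_prod_gen\<close>).

  The axioms are now short computations. The Leibniz identity is the one for \<open>d\<close>. The pre-Lie
  identity says that \<open>d (\<Phi> y) \<cdot> \<Phi> z - \<Phi> (d y \<cdot> \<Phi> z)\<close> is symmetric in \<open>y\<close> and \<open>z\<close>; it equals
  \<open>- \<lambda> \<Phi> (d (\<Phi> y) \<cdot> d (\<Phi> z))\<close> (\<open>bullet_prelie\<close>). For the coproduct,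
  \<open>\<Delta> \<circ> d = (d \<otimes> 1) \<circ> \<Delta> = (1 \<otimes> d) \<circ> \<Delta>\<close>, because all three are derivations along \<open>\<Delta>\<close> with the same
  values on vectors. Therefore \<open>\<Delta> \<circ> G = (G \<otimes> 1) \<circ> \<Delta>\<close>, and correcting the constant terms with the
  counit gives \<open>\<Delta> (\<Phi> y) = 1 \<otimes> \<Phi> y + (\<Phi> \<otimes> 1) (\<Delta> y)\<close>. Multiplying by \<open>\<Delta> (d x)\<close> yields the
  compatibility of product and coproduct (\<open>coprod_bullet\<close>).

  All these identities already hold in the polynomial algebra with one indeterminate for each vector,
  of which the symmetric algebra is a quotient; there they are equations between elements of
  commutative rings. The tensor square of that polynomial algebra is the algebra of the monoid of
  pairs of multisets. It remains to see that the operations pass to the quotient: linearity of \<open>f\<close>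
  makes the ideal stable under \<open>d\<close> (\<open>deriv_sym_ideal\<close>), hence under \<open>\<Phi>\<close>, and the generators of
  the ideal are primitive, so the coproduct sends the ideal to \<open>0\<close> (\<open>tcls_coprod_ideal\<close>). A Sweedler
  sum over a class in the tensor square is computed by comparing two linear maps on pairs of
  monomials (\<open>sweedler_tensor_lin\<close>). Finally \<open>sym_coproduct_iff\<close> and \<open>sym_bullet_iff\<close> show that
  the two specifications hold exactly for the operations obtained in this way, which gives existence,
  uniqueness and the axioms together.
\<close>

section \<open>Linear maps on finitely supported functions\<close>

text \<open>
  Scalar multiplication is a constant of its own: under a visible \<open>(*) c\<close> the simplifier
  would rewrite the partially applied product with the laws of multiplication.
\<close>

definition scal :: "'k::field \<Rightarrow> ('a \<Rightarrow>\<^sub>0 'k) \<Rightarrow> ('a \<Rightarrow>\<^sub>0 'k)"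
  where "scal c = Poly_Mapping.map ((*) c)"

abbreviation basis :: "'a \<Rightarrow> ('a \<Rightarrow>\<^sub>0 'k::field)"
  where "basis x \<equiv> Poly_Mapping.single x 1"

definition klin :: "(('a \<Rightarrow>\<^sub>0 'k::field) \<Rightarrow> ('b \<Rightarrow>\<^sub>0 'k)) \<Rightarrow> bool"
  where "klin F \<longleftrightarrow> (\<forall>p q. F (p + q) = F p + F q) \<and> (\<forall>c p. F (scal c p) = scal c (F p))"

definition ext :: "('a \<Rightarrow> ('b \<Rightarrow>\<^sub>0 'k::field)) \<Rightarrow> ('a \<Rightarrow>\<^sub>0 'k) \<Rightarrow> ('b \<Rightarrow>\<^sub>0 'k)"
  where "ext h p = (\<Sum>x\<in>Poly_Mapping.keys p. scal (Poly_Mapping.lookup p x) (h x))"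

lemma lookup_scal [simp]: "Poly_Mapping.lookup (scal c p) x = c * Poly_Mapping.lookup p x"
  by (simp add: scal_def Poly_Mapping.map.rep_eq when_def)

lemma scal_add_right: "scal c (p + q) = scal c p + scal c q"
  by (rule poly_mapping_eqI) (simp add: lookup_add algebra_simps)

lemma scal_add_left: "scal (c + d) p = scal c p + scal d p"
  by (rule poly_mapping_eqI) (simp add: lookup_add algebra_simps)

lemma scal_scal [simp]: "scal c (scal d p) = scal (c * d) p"
  by (rule poly_mapping_eqI) (simp add: mult.assoc)

lemma scal_one [simp]: "scal 1 p = p"
  by (rule poly_mapping_eqI) simp

lemma scal_zero [simp]: "scal 0 p = 0" "scal c 0 = 0"
  by (rule poly_mapping_eqI; simp)+

lemma scal_minus_one: "scal (- 1) p = - p"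
  by (rule poly_mapping_eqI) simp

lemma scal_diff_right: "scal c (p - q) = scal c p - scal c q"
  by (rule poly_mapping_eqI) (simp add: lookup_minus algebra_simps)

lemma scal_single [simp]: "scal c (Poly_Mapping.single x d) = Poly_Mapping.single x (c * d)"
  by (rule poly_mapping_eqI) (simp add: lookup_single when_def)

lemma single_eq_scal_basis: "Poly_Mapping.single x c = scal c (basis x)"
  by simp

lemma scal_sum: "scal c (sum g A) = (\<Sum>x\<in>A. scal c (g x))"
  by (induction A rule: infinite_finite_induct) (simp_all add: scal_add_right)

lemma scal_conv_mult: "scal c p = Poly_Mapping.single 0 c * p"
  for p :: "'a::monoid_add \<Rightarrow>\<^sub>0 'k::field"
  unfolding scal_def by (rule mult_map_scale_conv_mult)

lemma scal_mult_left: "scal c p * q = scal c (p * q)"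
  for p :: "'a::comm_monoid_add \<Rightarrow>\<^sub>0 'k::field"
  by (simp add: scal_conv_mult mult.assoc)

lemma scal_mult_right: "p * scal c q = scal c (p * q)"
  for p :: "'a::comm_monoid_add \<Rightarrow>\<^sub>0 'k::field"
  by (simp add: scal_conv_mult mult.left_commute)

lemma klinI: "(\<And>p q. F (p + q) = F p + F q) \<Longrightarrow> (\<And>c p. F (scal c p) = scal c (F p)) \<Longrightarrow> klin F"
  by (simp add: klin_def)

lemma klin_add: "klin F \<Longrightarrow> F (p + q) = F p + F q"
  and klin_scal: "klin F \<Longrightarrow> F (scal c p) = scal c (F p)"
  by (simp_all add: klin_def)

lemma klin_zero: "klin F \<Longrightarrow> F 0 = 0"
  using klin_scal[of F 0 0] by simp

lemma klin_uminus: "klin F \<Longrightarrow> F (- p) = - F p"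
  using klin_scal[of F "-1" p] by (simp add: scal_minus_one)

lemma klin_diff: "klin F \<Longrightarrow> F (p - q) = F p - F q"
  using klin_add[of F p "- q"] by (simp add: klin_uminus)

lemma klin_sum: "klin F \<Longrightarrow> F (sum g A) = (\<Sum>x\<in>A. F (g x))"
  by (induction A rule: infinite_finite_induct) (simp_all add: klin_add klin_zero)

lemma klin_sum_mset: "klin F \<Longrightarrow> F (\<Sum>x\<in>#M. g x) = (\<Sum>x\<in>#M. F (g x))"
  by (induction M) (simp_all add: klin_add klin_zero)

lemma klin_id: "klin (\<lambda>p. p)"
  by (simp add: klin_def)

lemma klin_comp: "klin F \<Longrightarrow> klin G \<Longrightarrow> klin (\<lambda>p. F (G p))"
  by (simp add: klin_def)

lemma klin_plus: "klin F \<Longrightarrow> klin G \<Longrightarrow> klin (\<lambda>p. F p + G p)"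
  and klin_minus: "klin F \<Longrightarrow> klin G \<Longrightarrow> klin (\<lambda>p. F p - G p)"
  and klin_scale: "klin F \<Longrightarrow> klin (\<lambda>p. scal c (F p))"
  by (simp_all add: klin_def scal_add_right scal_diff_right mult.commute)

lemma klin_mult_left: "klin F \<Longrightarrow> klin (\<lambda>p. F p * r)"
  and klin_mult_right: "klin F \<Longrightarrow> klin (\<lambda>p. r * F p)"
  for r :: "'b::comm_monoid_add \<Rightarrow>\<^sub>0 'k::field"
  by (simp_all add: klin_def scal_mult_left scal_mult_right distrib_left distrib_right)

lemma klin_funpow: "klin F \<Longrightarrow> klin (F ^^ n)"
  for F :: "('a \<Rightarrow>\<^sub>0 'k::field) \<Rightarrow> ('a \<Rightarrow>\<^sub>0 'k)"
  by (induction n) (auto simp: klin_def)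

lemma ext_superset:
  fixes p :: "'a \<Rightarrow>\<^sub>0 'k::field"
  assumes "finite A" "Poly_Mapping.keys p \<subseteq> A"
  shows "ext h p = (\<Sum>x\<in>A. scal (Poly_Mapping.lookup p x) (h x))"
  unfolding ext_def using assms
  by (intro sum.mono_neutral_left) (auto simp: in_keys_iff)

lemma klin_ext [simp]: "klin (ext h)"
  for h :: "'a \<Rightarrow> ('b \<Rightarrow>\<^sub>0 'k::field)"
proof (rule klinI)
  fix p q :: "'a \<Rightarrow>\<^sub>0 'k" and c :: 'k
  let ?A = "Poly_Mapping.keys p \<union> Poly_Mapping.keys q"
  have "Poly_Mapping.keys (p + q) \<subseteq> ?A"
    by (rule Poly_Mapping.keys_add)
  then show "ext h (p + q) = ext h p + ext h q"
    by (simp add: ext_superset[of ?A] lookup_add scal_add_left sum.distrib)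
  have "Poly_Mapping.keys (scal c p) \<subseteq> Poly_Mapping.keys p"
    by (auto simp: in_keys_iff)
  then show "ext h (scal c p) = scal c (ext h p)"
    by (simp add: ext_superset[of "Poly_Mapping.keys p"] scal_sum)
qed

lemma ext_single [simp]: "ext h (Poly_Mapping.single x c) = scal c (h x)"
  by (simp add: ext_superset[of "{x}"])

lemma ext_basis: "ext basis p = p"
  by (rule poly_mapping_eqI)
     (auto simp: ext_def lookup_sum lookup_single when_def in_keys_iff)

lemma klin_expand:
  assumes "klin F"
  shows "F p = ext (\<lambda>x. F (basis x)) p"
proof -
  have "F p = F (ext basis p)" by (simp add: ext_basis)
  also have "\<dots> = ext (\<lambda>x. F (basis x)) p"
    unfolding ext_def klin_sum[OF assms] by (intro sum.cong refl) (rule klin_scal[OF assms])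
  finally show ?thesis .
qed

lemma klin_eqI:
  assumes "klin F" "klin G" "\<And>x. F (basis x) = G (basis x)"
  shows "F p = G p"
  unfolding klin_expand[OF assms(1), of p] klin_expand[OF assms(2), of p] by (simp add: assms(3))

lemma poly_mapping_linear_induct [case_names zero basis add scal]:
  assumes "P 0" "\<And>x. P (basis x)" "\<And>p q. P p \<Longrightarrow> P q \<Longrightarrow> P (p + q)"
    and "\<And>c p. P p \<Longrightarrow> P (scal c p)"
  shows "P (p :: 'a \<Rightarrow>\<^sub>0 'k::field)"
proof -
  have "P (\<Sum>x\<in>A. scal (Poly_Mapping.lookup p x) (basis x))" if "finite A" for A
    using that
  proof (induction A)
    case (insert x A)
    then show ?case
      unfolding sum.insert[OF insert(1,2)] by (intro assms)
  qed (simp add: assms(1))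
  from this[OF finite_keys[of p]] show ?thesis
    unfolding ext_def[symmetric] ext_basis .
qed

subsection \<open>Tensor products of spaces with a basis\<close>

text \<open>
  The tensor product of the spaces with bases \<open>'a\<close> and \<open>'b\<close> is the space with basis
  \<open>'a \<times> 'b\<close>; this is its universal bilinear map.
\<close>

definition tens :: "('a \<Rightarrow>\<^sub>0 'k::field) \<Rightarrow> ('b \<Rightarrow>\<^sub>0 'k) \<Rightarrow> ('a \<times> 'b \<Rightarrow>\<^sub>0 'k)"
  where "tens p q = ext (\<lambda>x. ext (\<lambda>y. basis (x, y)) q) p"

definition tmap :: "(('a \<Rightarrow>\<^sub>0 'k::field) \<Rightarrow> ('c \<Rightarrow>\<^sub>0 'k)) \<Rightarrow> (('b \<Rightarrow>\<^sub>0 'k) \<Rightarrow> ('d \<Rightarrow>\<^sub>0 'k)) \<Rightarrow>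
    ('a \<times> 'b \<Rightarrow>\<^sub>0 'k) \<Rightarrow> ('c \<times> 'd \<Rightarrow>\<^sub>0 'k)"
  where "tmap F G = ext (\<lambda>(x, y). tens (F (basis x)) (G (basis y)))"

lemma klin_tens_left: "klin (\<lambda>p. tens p q)"
  unfolding tens_def by (rule klin_ext)

lemma klin_tens_right: "klin (\<lambda>q. tens p q)"
proof (rule klinI)
  show "tens p (q + q') = tens p q + tens p q'" for q q'
    by (simp add: tens_def klin_add[OF klin_ext] ext_def[of _ p] scal_add_right sum.distrib)
  show "tens p (scal c q) = scal c (tens p q)" for c q
    by (simp add: tens_def klin_scal[OF klin_ext] ext_def[of _ p] scal_sum mult.commute)
qed

lemma tens_basis [simp]: "tens (basis x) (basis y) = basis (x, y)"
  by (simp add: tens_def)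

lemma klin_tmap [simp]: "klin (tmap F G)"
  unfolding tmap_def by (rule klin_ext)

lemmas klin_intros = klin_id klin_plus klin_minus klin_scale klin_mult_left klin_mult_right
  klin_ext klin_comp[OF klin_ext] klin_tens_left klin_tens_right
  klin_comp[OF klin_tens_left] klin_comp[OF klin_tens_right] klin_tmap klin_comp[OF klin_tmap]

lemma tmap_basis: "tmap F G (basis (x, y)) = tens (F (basis x)) (G (basis y))"
  by (simp add: tmap_def)

lemma klin2_eqI:
  assumes "\<And>q. klin (\<lambda>p. F p q)" "\<And>p. klin (F p)" "\<And>q. klin (\<lambda>p. G p q)" "\<And>p. klin (G p)"
    and "\<And>x y. F (basis x) (basis y) = G (basis x) (basis y)"
  shows "F p q = G p q"
  by (rule klin_eqI[of "\<lambda>p. F p q" "\<lambda>p. G p q"], rule assms, rule assms)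
     (rule klin_eqI, rule assms, rule assms, rule assms)

lemma tmap_tens:
  assumes "klin F" "klin G"
  shows "tmap F G (tens p q) = tens (F p) (G q)"
  by (rule klin2_eqI[of "\<lambda>p q. tmap F G (tens p q)" "\<lambda>p q. tens (F p) (G q)"])
     (simp_all add: tmap_basis klin_intros assms klin_comp[of F, OF assms(1)] klin_comp[of G, OF assms(2)])

subsection \<open>Monoid algebras\<close>

lemma basis_add: "basis (x + y) = basis x * basis y"
  for x y :: "'a::comm_monoid_add"
  by (simp add: mult_single)

definition khom :: "(('a::comm_monoid_add \<Rightarrow>\<^sub>0 'k::field) \<Rightarrow> ('b::comm_monoid_add \<Rightarrow>\<^sub>0 'k)) \<Rightarrow> bool"
  where "khom F \<longleftrightarrow> klin F \<and> F 1 = 1 \<and> (\<forall>p q. F (p * q) = F p * F q)"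

lemma khom_klin: "khom F \<Longrightarrow> klin F"
  and khom_one: "khom F \<Longrightarrow> F 1 = 1"
  and khom_mult: "khom F \<Longrightarrow> F (p * q) = F p * F q"
  by (simp_all add: khom_def)

text \<open>
  Both sides of the multiplicative law are bilinear, so basis elements suffice.
\<close>

lemma khomI:
  assumes "klin F" "F 1 = 1" "\<And>x y. F (basis (x + y)) = F (basis x) * F (basis y)"
  shows "khom F"
proof -
  have "F (p * q) = F p * F q" for p q
    by (rule klin2_eqI[of "\<lambda>p q. F (p * q)" "\<lambda>p q. F p * F q"])
       (use assms in \<open>simp_all add: klin_intros klin_comp[of F] flip: basis_add\<close>)
  then show ?thesis using assms by (simp add: khom_def)
qed

lemma khom_id: "khom (\<lambda>p. p)"
  by (simp add: khom_def klin_id)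

lemma khom_comp: "khom F \<Longrightarrow> khom G \<Longrightarrow> khom (\<lambda>p. F (G p))"
  by (simp add: khom_def klin_comp)

lemma khom_ext: "h 0 = 1 \<Longrightarrow> (\<And>x y. h (x + y) = h x * h y) \<Longrightarrow> khom (ext h)"
  by (rule khomI) (simp_all flip: single_one)

lemma tens_one: "tens 1 1 = 1"
  using tens_basis[of 0 0] by (simp add: zero_prod_def[symmetric])

lemma tens_mult: "tens p q * tens p' q' = tens (p * p') (q * q')"
  for p p' :: "'a::comm_monoid_add \<Rightarrow>\<^sub>0 'k::field" and q q' :: "'b::comm_monoid_add \<Rightarrow>\<^sub>0 'k"
proof (rule klin2_eqI[of "\<lambda>p q. tens p q * tens p' q'" "\<lambda>p q. tens (p * p') (q * q')"])
  fix x :: 'a and y :: 'b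
  show "tens (basis x) (basis y) * tens p' q' = tens (basis x * p') (basis y * q')"
    by (rule klin2_eqI[of "\<lambda>p' q'. tens (basis x) (basis y) * tens p' q'"
          "\<lambda>p' q'. tens (basis x * p') (basis y * q')"])
       (simp_all add: klin_intros flip: basis_add)
qed (simp_all add: klin_intros)

lemma khom_tmap:
  assumes "khom F" "khom G"
  shows "khom (tmap F G)"
proof (rule khomI)
  show "tmap F G 1 = 1"
    using tmap_tens[OF khom_klin khom_klin, OF assms, of 1 1]
    by (simp add: tens_one assms[THEN khom_one])
  show "tmap F G (basis (x + y)) = tmap F G (basis x) * tmap F G (basis y)" for x y
    using assms by (cases x; cases y) (simp add: tmap_basis tens_mult khom_mult basis_add)
qed simp

section \<open>The product on polynomials\<close>

text \<open>
  Multisets are monomials and addition of multisets is multiplication of monomials, so that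
  \<open>'v multiset \<Rightarrow>\<^sub>0 'k\<close> is the polynomial algebra with the indeterminates \<open>gen v\<close>.
\<close>

abbreviation gen :: "'v \<Rightarrow> ('v multiset \<Rightarrow>\<^sub>0 'k::field)"
  where "gen v \<equiv> basis {#v#}"

lemma basis_add_mset: "basis (add_mset v m) = gen v * basis m"
  by (simp flip: basis_add)

lemma basis_multiset_induct:
  assumes "P 1" "\<And>v m. P (basis m) \<Longrightarrow> P (gen v * basis m)"
  shows "P (basis m)"
proof (induction m)
  case (add v m)
  then show ?case by (subst basis_add_mset) (rule assms(2))
qed (simp add: assms(1))

lemma khom_eqI:
  assumes "khom F" "khom G" "\<And>v. F (gen v) = G (gen v)"
  shows "F p = G p"
proof (rule klin_eqI[of F G])
  show "F (basis m) = G (basis m)" for m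
    by (rule basis_multiset_induct[of "\<lambda>p. F p = G p"]) (simp_all add: assms khom_one khom_mult)
qed (use assms in \<open>simp_all add: khom_klin\<close>)

text \<open>
  The derivation of the polynomial algebra that sends the indeterminate \<open>gen v\<close> to the constant
  \<open>f v\<close>: every occurrence of a factor \<open>v\<close> in a monomial is replaced in turn.
\<close>

definition deriv :: "('v \<Rightarrow> 'k::field) \<Rightarrow> ('v multiset \<Rightarrow>\<^sub>0 'k) \<Rightarrow> ('v multiset \<Rightarrow>\<^sub>0 'k)"
  where "deriv f = ext (\<lambda>m. \<Sum>v\<in>#m. Poly_Mapping.single (m - {#v#}) (f v))"

lemma klin_deriv: "klin (deriv f)"
  by (simp add: deriv_def)

lemmas klin_deriv' = klin_deriv klin_comp[OF klin_deriv]

lemma deriv_gen [simp]: "deriv f (gen v) = scal (f v) 1"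
  by (simp add: deriv_def flip: single_one)

lemma deriv_one [simp]: "deriv f 1 = 0"
  by (simp add: deriv_def flip: single_one)

lemma deriv_mult: "deriv f (p * q) = deriv f p * q + p * deriv f q"
proof (rule klin2_eqI[of "\<lambda>p q. deriv f (p * q)" "\<lambda>p q. deriv f p * q + p * deriv f q"])
  fix m n :: "'a multiset"
  have 1: "(\<Sum>v\<in>#m. Poly_Mapping.single (m + n - {#v#}) (f v)) =
      (\<Sum>v\<in>#m. Poly_Mapping.single (m - {#v#}) (f v)) * basis n"
    unfolding sum_mset_distrib_right
    by (intro arg_cong[where f = sum_mset] image_mset_cong) (simp add: mult_single)
  have 2: "(\<Sum>v\<in>#n. Poly_Mapping.single (m + n - {#v#}) (f v)) =
      basis m * (\<Sum>v\<in>#n. Poly_Mapping.single (n - {#v#}) (f v))"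
    unfolding sum_mset_distrib_left
    by (intro arg_cong[where f = sum_mset] image_mset_cong) (simp add: mult_single)
  show "deriv f (basis m * basis n) = deriv f (basis m) * basis n + basis m * deriv f (basis n)"
    using 1 2 by (simp add: deriv_def flip: basis_add)
qed (simp_all add: klin_intros klin_deriv')

lemma deriv_prod:
  "finite A \<Longrightarrow> deriv f (\<Prod>i\<in>A. g i) = (\<Sum>i\<in>A. deriv f (g i) * (\<Prod>j\<in>A - {i}. g j))"
proof (induction A rule: finite_induct)
  case (insert a A)
  have "(\<Sum>i\<in>A. deriv f (g i) * prod g (insert a A - {i})) =
      (\<Sum>i\<in>A. g a * (deriv f (g i) * prod g (A - {i})))"
  proof (rule sum.cong[OF refl])
    fix i assume "i \<in> A"
    then have "insert a A - {i} = insert a (A - {i})" "a \<notin> A - {i}" using insert by auto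
    then show "deriv f (g i) * prod g (insert a A - {i}) = g a * (deriv f (g i) * prod g (A - {i}))"
      using insert by (simp add: mult_ac)
  qed
  with insert show ?case by (simp add: deriv_mult sum_distrib_left)
qed simp

lemma funpow_zero_mono:
  fixes D :: "('a \<Rightarrow>\<^sub>0 'k::field) \<Rightarrow> ('a \<Rightarrow>\<^sub>0 'k)"
  assumes "klin D" "(D ^^ n) p = 0" "n \<le> m"
  shows "(D ^^ m) p = 0"
proof -
  have "(D ^^ m) p = (D ^^ (m - n)) ((D ^^ n) p)"
    using assms(3) funpow_add[of "m - n" n D] by simp
  then show ?thesis
    using assms by (simp add: klin_zero klin_funpow)
qed

text \<open>
  Each application lowers the degree of a monomial by one.
\<close>

lemma deriv_nilpotent: "\<exists>n. (deriv f ^^ n) p = 0"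
proof (induction p rule: poly_mapping_linear_induct)
  case zero
  then show ?case by (intro exI[of _ 0]) simp
next
  case (basis m)
  have "(deriv f ^^ Suc n) (basis m) = 0" if "size m \<le> n" for n m
    using that
  proof (induction n arbitrary: m)
    case (Suc n)
    have "(deriv f ^^ Suc (Suc n)) (basis m) =
        (deriv f ^^ Suc n) (\<Sum>v\<in>#m. Poly_Mapping.single (m - {#v#}) (f v))"
      unfolding funpow_Suc_right[of "Suc n"] by (simp add: deriv_def)
    also have "\<dots> = (\<Sum>v\<in>#m. scal (f v) ((deriv f ^^ Suc n) (basis (m - {#v#}))))"
      unfolding klin_sum_mset[OF klin_funpow[OF klin_deriv]]
      by (subst single_eq_scal_basis) (simp only: klin_scal[OF klin_funpow[OF klin_deriv]])
    also have "\<dots> = (\<Sum>v\<in>#m. 0)"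
      using Suc by (intro arg_cong[where f = sum_mset] image_mset_cong)
        (auto simp: size_Diff_singleton simp del: funpow.simps)
    finally show ?case by simp
  qed simp
  then show ?case by blast
next
  case (add p q)
  then obtain n n' where *: "(deriv f ^^ n) p = 0" "(deriv f ^^ n') q = 0" by blast
  have "(deriv f ^^ (max n n')) (p + q) = 0"
    using funpow_zero_mono[OF klin_deriv *(1), of "max n n'"]
      funpow_zero_mono[OF klin_deriv *(2), of "max n n'"]
    by (simp add: klin_add[OF klin_funpow[OF klin_deriv]])
  then show ?case by blast
next
  case (scal c p)
  then obtain n where "(deriv f ^^ n) p = 0" by blast
  then have "(deriv f ^^ n) (scal c p) = 0"
    by (simp add: klin_scal[OF klin_funpow[OF klin_deriv]])
  then show ?case by blast
qed

text \<open>
  Local nilpotency in the form of an induction principle: a property that passes from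
  \<open>deriv f p\<close> back to \<open>p\<close> can be traced back to \<open>0\<close>.
\<close>

lemma deriv_induct:
  assumes "P 0" "\<And>p. P (deriv f p) \<Longrightarrow> P p"
  shows "P p"
proof -
  obtain n where "(deriv f ^^ n) p = 0"
    using deriv_nilpotent[of f p] by (elim exE)
  then show ?thesis
  proof (induction n arbitrary: p)
    case 0
    then show ?case using assms(1) by simp
  next
    case (Suc n)
    then have "(deriv f ^^ n) (deriv f p) = 0"
      by (simp add: funpow_swap1)
    from assms(2)[OF Suc.IH[OF this]] show ?case .
  qed
qed

text \<open>
  The inverse of \<open>1 - l d\<close> as a geometric series in \<open>d = deriv f\<close>. Local nilpotency makes
  the index set finite.
\<close>

definition resolvent :: "'k \<Rightarrow> ('v \<Rightarrow> 'k::field) \<Rightarrow> ('v multiset \<Rightarrow>\<^sub>0 'k) \<Rightarrow> ('v multiset \<Rightarrow>\<^sub>0 'k)"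
  where "resolvent l f p = (\<Sum>n | (deriv f ^^ n) p \<noteq> 0. scal (l ^ n) ((deriv f ^^ n) p))"

text \<open>
  With an arbitrary bound the series of different polynomials can be brought to a common range.
\<close>

lemma resolvent_eq_sum:
  assumes "(deriv f ^^ N) p = 0"
  shows "resolvent l f p = (\<Sum>n<N. scal (l ^ n) ((deriv f ^^ n) p))"
  unfolding resolvent_def
proof (rule sum.mono_neutral_left)
  show "{n. (deriv f ^^ n) p \<noteq> 0} \<subseteq> {..<N}"
  proof
    fix n assume "n \<in> {n. (deriv f ^^ n) p \<noteq> 0}"
    then have "\<not> N \<le> n" using funpow_zero_mono[OF klin_deriv assms, of n] by blast
    then show "n \<in> {..<N}" by simp
  qed
  show "\<forall>n\<in>{..<N} - {n. (deriv f ^^ n) p \<noteq> 0}. scal (l ^ n) ((deriv f ^^ n) p) = 0"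
    by simp
qed simp

lemma klin_resolvent: "klin (resolvent l f)"
proof (rule klinI)
  fix p q :: "'a multiset \<Rightarrow>\<^sub>0 'b" and c :: 'b
  obtain n where n: "(deriv f ^^ n) p = 0"
    using deriv_nilpotent[of f p] by (elim exE)
  obtain n' where n': "(deriv f ^^ n') q = 0"
    using deriv_nilpotent[of f q] by (elim exE)
  note * = n n'
  define N where "N = max n n'"
  have N: "(deriv f ^^ N) p = 0" "(deriv f ^^ N) q = 0"
    using funpow_zero_mono[OF klin_deriv *(1), of N] funpow_zero_mono[OF klin_deriv *(2), of N]
    by (simp_all add: N_def)
  then have N': "(deriv f ^^ N) (p + q) = 0" "(deriv f ^^ N) (scal c p) = 0"
    by (simp_all add: klin_add[OF klin_funpow[OF klin_deriv]] klin_scal[OF klin_funpow[OF klin_deriv]])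
  show "resolvent l f (p + q) = resolvent l f p + resolvent l f q"
    by (simp add: resolvent_eq_sum[OF N'(1)] resolvent_eq_sum[OF N(1)] resolvent_eq_sum[OF N(2)]
        klin_add[OF klin_funpow[OF klin_deriv]] scal_add_right sum.distrib)
  show "resolvent l f (scal c p) = scal c (resolvent l f p)"
    by (simp add: resolvent_eq_sum[OF N'(2)] resolvent_eq_sum[OF N(1)]
        klin_scal[OF klin_funpow[OF klin_deriv]] scal_sum mult.commute)
qed

lemma resolvent_deriv: "resolvent l f p = p + scal l (resolvent l f (deriv f p))"
proof -
  obtain n where n: "(deriv f ^^ n) p = 0"
    using deriv_nilpotent[of f p] by (elim exE)
  have Sn: "(deriv f ^^ Suc n) p = 0" and n': "(deriv f ^^ n) (deriv f p) = 0"
    using n by (simp_all add: klin_zero[OF klin_deriv] funpow_swap1[symmetric])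
  show ?thesis
    by (simp add: resolvent_eq_sum[OF Sn] resolvent_eq_sum[OF n'] sum.lessThan_Suc_shift
        scal_sum funpow_swap1 del: sum.lessThan_Suc)
qed

lemma deriv_resolvent: "deriv f (resolvent l f p) = resolvent l f (deriv f p)"
proof (induction p rule: deriv_induct[of _ f])
  case 1
  show ?case by (simp add: klin_zero klin_deriv klin_resolvent)
next
  case (2 p)
  have "deriv f (resolvent l f p) = deriv f p + scal l (deriv f (resolvent l f (deriv f p)))"
    by (subst resolvent_deriv) (simp add: klin_add[OF klin_deriv] klin_scal[OF klin_deriv])
  also have "\<dots> = resolvent l f (deriv f p)"
    unfolding 2 by (rule resolvent_deriv[symmetric])
  finally show ?case .
qed

lemma resolvent_left: "resolvent l f p - scal l (resolvent l f (deriv f p)) = p"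
  by (subst resolvent_deriv) simp

lemma resolvent_right: "resolvent l f p - scal l (deriv f (resolvent l f p)) = p"
  by (simp add: deriv_resolvent resolvent_left)

text \<open>
  The series is the inverse of \<open>1 - l d\<close>, so its value is found by solving an equation.
\<close>

lemma resolvent_eqI: "p - scal l (deriv f p) = q \<Longrightarrow> resolvent l f q = p"
  using resolvent_left[of l f p]
  by (auto simp: klin_diff[OF klin_resolvent] klin_scal[OF klin_resolvent])

text \<open>
  Let \<open>u\<close> be the right-hand side; it suffices that \<open>u - l d u\<close> is the product. Differentiating
  the term of \<open>I\<close> moves one index from the complement into \<open>I\<close>. A nonempty set \<open>I\<close> is reached in
  \<open>card I\<close> ways, which turns the factor \<open>(card I - 1)!\<close> into \<open>(card I)!\<close>. So \<open>l d u\<close> consists of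
  the terms of \<open>u\<close> with \<open>I \<noteq> {}\<close>, and the term of \<open>{}\<close> is the product.
\<close>

lemma resolvent_prod_gen:
  fixes f :: "'v \<Rightarrow> 'k::field"
  assumes "finite A"
  shows "resolvent l f (\<Prod>i\<in>A. gen (x i)) =
    (\<Sum>I\<in>Pow A. scal (of_nat (fact (card I)) * l ^ card I * (\<Prod>i\<in>I. f (x i))) (\<Prod>i\<in>A - I. gen (x i)))"
    (is "_ = ?R")
proof (rule resolvent_eqI)
  define c where "c n = of_nat (fact n) * l ^ n" for n
  define P where "P I = (\<Prod>i\<in>I. f (x i))" for I
  define M where "M I = (\<Prod>i\<in>A - I. gen (x i) :: 'v multiset \<Rightarrow>\<^sub>0 'k)" for I
  have R: "?R = (\<Sum>I\<in>Pow A. scal (c (card I) * P I) (M I))"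
    unfolding c_def P_def M_def ..
  have fin: "I \<subseteq> A \<Longrightarrow> finite I" for I
    using finite_subset[OF _ assms] by simp
  have dM: "deriv f (M I) = (\<Sum>j\<in>A - I. scal (f (x j)) (M (insert j I)))" for I
    unfolding M_def deriv_prod[OF finite_Diff[OF assms]]
  proof (rule sum.cong[OF refl])
    fix j
    have "A - I - {j} = A - insert j I" by blast
    then show "deriv f (gen (x j)) * (\<Prod>i\<in>A - I - {j}. gen (x i)) =
        scal (f (x j)) (\<Prod>i\<in>A - insert j I. gen (x i))"
      by (simp only: deriv_gen scal_mult_left mult_1_left)
  qed
  have "scal l (deriv f ?R) =
      (\<Sum>I\<in>Pow A. \<Sum>j\<in>A - I. scal (l * c (card I) * P I * f (x j)) (M (insert j I)))"
    unfolding R by (simp add: klin_sum[OF klin_deriv] klin_scal[OF klin_deriv] scal_sum dM mult.assoc)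
  also have "\<dots> = (\<Sum>(I, j)\<in>Sigma (Pow A) (\<lambda>I. A - I).
      scal (l * c (card I) * P I * f (x j)) (M (insert j I)))"
    using assms by (subst sum.Sigma) auto
  \<comment> \<open>The pair of \<open>I\<close> and a new index \<open>j\<close> becomes the pair of \<open>insert j I\<close> and its element \<open>j\<close>.\<close>
  also have "\<dots> = (\<Sum>(I, j)\<in>Sigma (Pow A) (\<lambda>I. I).
      scal (l * c (card I - 1) * P I) (M I))"
  proof (rule sum.reindex_bij_witness[of _ "\<lambda>(I, j). (I - {j}, j)" "\<lambda>(I, j). (insert j I, j)"], goal_cases)
    case (5 a)
    then obtain I j where "a = (I, j)" "I \<subseteq> A" "j \<notin> I" "j \<in> A" by auto
    moreover have "P (insert j I) = f (x j) * P I"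
      using calculation fin[of I] by (simp add: P_def)
    ultimately show ?case using fin[of I] by (simp add: mult_ac)
  qed auto
  also have "\<dots> = (\<Sum>I\<in>Pow A. \<Sum>j\<in>I. scal (l * c (card I - 1) * P I) (M I))"
    using assms fin by (subst sum.Sigma) auto
  also have "\<dots> = (\<Sum>I\<in>Pow A - {{}}. \<Sum>j\<in>I. scal (l * c (card I - 1) * P I) (M I))"
    using assms by (intro sum.mono_neutral_right) auto
  also have "\<dots> = (\<Sum>I\<in>Pow A - {{}}. scal (c (card I) * P I) (M I))"
  proof (intro sum.cong refl)
    fix I assume I: "I \<in> Pow A - {{}}"
    have s: "(\<Sum>j\<in>I. p) = scal (of_nat (card I)) p" for p :: "'v multiset \<Rightarrow>\<^sub>0 'k"
      by (simp add: scal_conv_mult)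
    obtain n where "card I = Suc n"
      using I fin[of I] by (cases "card I") auto
    then show "(\<Sum>j\<in>I. scal (l * c (card I - 1) * P I) (M I)) = scal (c (card I) * P I) (M I)"
      unfolding s by (simp add: c_def algebra_simps)
  qed
  also have "\<dots> = ?R - M {}"
    unfolding R using assms by (subst (2) sum.remove[of _ "{}"]) (auto simp: c_def P_def)
  finally show "?R - scal l (deriv f ?R) = (\<Prod>i\<in>A. gen (x i))"
    by (simp add: M_def)
qed

text \<open>
  The coefficient of the unit of the monoid. For polynomials it is the constant term; it induces
  the counit of the symmetric algebra.
\<close>

definition eps :: "('a::zero \<Rightarrow>\<^sub>0 'k::field) \<Rightarrow> 'k"
  where "eps p = Poly_Mapping.lookup p 0"

lemma eps_add [simp]: "eps (p + q) = eps p + eps q"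
  and eps_diff [simp]: "eps (p - q) = eps p - eps q"
  and eps_scal [simp]: "eps (scal c p) = c * eps p"
  and eps_zero [simp]: "eps 0 = 0"
  by (simp_all add: eps_def lookup_add lookup_minus)

lemma eps_one [simp]: "eps 1 = 1"
  by (simp add: eps_def)

lemma eps_basis: "eps (basis m) = (if m = 0 then 1 else 0)"
  by (simp add: eps_def lookup_single when_def)

lemma klin_eps: "klin F \<Longrightarrow> klin (\<lambda>p. scal (eps (F p)) q)"
  by (rule klinI) (simp_all add: klin_add klin_scal scal_add_left)

lemma eps_mult [simp]: "eps (p * q) = eps p * eps q"
  for p q :: "'v multiset \<Rightarrow>\<^sub>0 'k::field"
proof -
  let ?F = "\<lambda>p q. scal (eps (p * q)) (1 :: 'v multiset \<Rightarrow>\<^sub>0 'k)"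
  let ?G = "\<lambda>p q. scal (eps p) 1 * scal (eps q) (1 :: 'v multiset \<Rightarrow>\<^sub>0 'k)"
  have "?F p q = ?G p q"
  proof (rule klin2_eqI[of ?F ?G])
    fix m n :: "'v multiset"
    have "eps (basis (m + n) :: 'v multiset \<Rightarrow>\<^sub>0 'k) = (if m + n = 0 then 1 else 0)"
      by (rule eps_basis)
    then show "?F (basis m) (basis n) = ?G (basis m) (basis n)"
      by (simp add: eps_basis basis_add)
  qed (intro klin_eps klin_mult_left klin_mult_right klin_id)+
  then have "eps (?F p q) = eps (?G p q)" by simp
  then show ?thesis
    by (simp only: eps_scal eps_one scal_mult_left scal_mult_right mult_1_right scal_scal
        mult.commute[of "eps q"])
qed

text \<open>
  For a product of \<open>k\<close> indeterminates the constant term of the series is the summand of the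
  full index set, so subtracting it leaves the proper subsets.
\<close>

definition trunc_resolvent ::
    "'k \<Rightarrow> ('v \<Rightarrow> 'k::field) \<Rightarrow> ('v multiset \<Rightarrow>\<^sub>0 'k) \<Rightarrow> ('v multiset \<Rightarrow>\<^sub>0 'k)"
  where "trunc_resolvent l f p = resolvent l f p - scal (eps (resolvent l f p)) 1"

lemma klin_trunc_resolvent: "klin (trunc_resolvent l f)"
  unfolding trunc_resolvent_def
  by (rule klin_minus[OF klin_resolvent klin_eps[OF klin_resolvent]])

text \<open>
  The closed form of the product, with \<open>deriv\<close> and \<open>trunc_resolvent\<close> in the roles of
  \<open>d\<close> and \<open>\<Phi>\<close>.
\<close>

definition bullet :: "'k \<Rightarrow> ('v \<Rightarrow> 'k::field) \<Rightarrow> ('v multiset \<Rightarrow>\<^sub>0 'k) \<Rightarrow> ('v multiset \<Rightarrow>\<^sub>0 'k) \<Rightarrow>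
    ('v multiset \<Rightarrow>\<^sub>0 'k)"
  where "bullet l f p q = deriv f p * trunc_resolvent l f q"

lemma klin_bullet_left: "klin (\<lambda>p. bullet l f p q)"
  unfolding bullet_def by (rule klin_mult_left[OF klin_deriv])

lemma klin_bullet_right: "klin (bullet l f p)"
  unfolding bullet_def by (rule klin_mult_right[OF klin_trunc_resolvent])

text \<open>
  The Leibniz rule reduces the associator of \<open>p, q, r\<close> to a part symmetric in \<open>q, r\<close> and
  \<open>d p\<close> times \<open>d (\<Phi> q) \<cdot> \<Phi> r - \<Phi> (d q \<cdot> \<Phi> r)\<close>; the fact \<open>key\<close> evaluates the latter to a
  symmetric expression.
\<close>

lemma bullet_prelie:
  "bullet l f (bullet l f p q) r - bullet l f p (bullet l f q r) =
   bullet l f (bullet l f p r) q - bullet l f p (bullet l f r q)"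
proof -
  define D where "D = deriv f"
  define T where "T = trunc_resolvent l f"
  \<comment> \<open>With \<open>u = G q\<close> and \<open>t = \<Phi> r\<close> one has \<open>d q \<cdot> t = (1 - l d) (d u \<cdot> t) + l (d u \<cdot> d t)\<close>. Applying
    \<open>\<Phi>\<close> turns the first summand into \<open>d u \<cdot> t\<close>, whose constant term is \<open>0\<close> like that of \<open>t\<close>.\<close>
  have key: "D (T q) * T r - T (D q * T r) = - scal l (T (D (T q) * D (T r)))" for q r
  proof -
    define u where "u = resolvent l f q"
    define t where "t = T r"
    have Tq: "T q = u - scal (eps u) 1" and DT: "D (T q) = D u"
      by (simp_all add: T_def trunc_resolvent_def u_def D_def klin_diff[OF klin_deriv]
          klin_scal[OF klin_deriv])
    have q: "q = u - scal l (D u)"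
      by (simp add: u_def D_def resolvent_right)
    have et: "eps t = 0"
      by (simp add: t_def T_def trunc_resolvent_def)
    have T_eq: "T (z - scal l (D z)) = z - scal (eps z) 1" for z
      unfolding T_def D_def trunc_resolvent_def by (simp add: resolvent_eqI)
    have "D q * t = D u * t - scal l (D (D u) * t)"
      unfolding q by (simp add: D_def klin_diff[OF klin_deriv] klin_scal[OF klin_deriv]
          scal_mult_left left_diff_distrib)
    also have "\<dots> = (D u * t - scal l (D (D u * t))) + scal l (D u * D t)"
      by (simp add: D_def deriv_mult scal_add_right)
    finally have "T (D q * t) = D u * t + scal l (T (D u * D t))"
      using klin_add[OF klin_trunc_resolvent[of l f]] klin_scal[OF klin_trunc_resolvent[of l f]]
        T_eq[of "D u * t"] et by (simp add: T_def)
    then show ?thesis by (simp add: DT t_def)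
  qed
  have *: "bullet l f (bullet l f p q) r - bullet l f p (bullet l f q r) =
      D (D p) * (T q * T r) + D p * (D (T q) * T r - T (D q * T r))" for q r
    by (simp add: bullet_def D_def T_def deriv_mult algebra_simps)
  show ?thesis
    unfolding * key by (simp add: mult.commute)
qed

lemma bullet_leibniz: "bullet l f (p * q) r = bullet l f p r * q + p * bullet l f q r"
  by (simp add: bullet_def deriv_mult algebra_simps)

lemma bullet_one: "bullet l f 1 p = 0"
  by (simp add: bullet_def)

lemma eps_prod_gen: "finite A \<Longrightarrow> eps (\<Prod>i\<in>A. gen (x i)) = (if A = {} then 1 else 0)"
  by (induction A rule: finite_induct) (auto simp: eps_basis)

lemma eps_sum: "eps (sum g A) = (\<Sum>x\<in>A. eps (g x))"
  by (simp add: eps_def lookup_sum)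

lemma bullet_gen_prod:
  fixes f :: "'v \<Rightarrow> 'k::field"
  assumes "finite A"
  shows "bullet l f (gen v) (\<Prod>i\<in>A. gen (x i)) =
    (\<Sum>I | I \<subset> A. scal (of_nat (fact (card I)) * l ^ card I * f v * (\<Prod>i\<in>I. f (x i)))
       (\<Prod>i\<in>A - I. gen (x i)))"
proof -
  define c where "c I = of_nat (fact (card I)) * l ^ card I * (\<Prod>i\<in>I. f (x i))" for I
  let ?M = "\<lambda>I. \<Prod>i\<in>A - I. gen (x i) :: 'v multiset \<Rightarrow>\<^sub>0 'k"
  have Pow: "Pow A = insert A {I. I \<subset> A}" by auto
  have fin: "finite {I. I \<subset> A}"
    using assms by (rule_tac finite_subset[of _ "Pow A"]) auto
  have R: "resolvent l f (\<Prod>i\<in>A. gen (x i)) = scal (c A) 1 + (\<Sum>I | I \<subset> A. scal (c I) (?M I))"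
    unfolding resolvent_prod_gen[OF assms] c_def[symmetric] Pow using fin by simp
  have "A - I \<noteq> {}" if "I \<subset> A" for I using that by auto
  then have "eps (\<Sum>I | I \<subset> A. scal (c I) (?M I)) = 0"
    using assms by (simp add: eps_sum eps_prod_gen)
  then have "trunc_resolvent l f (\<Prod>i\<in>A. gen (x i)) = (\<Sum>I | I \<subset> A. scal (c I) (?M I))"
    by (simp add: trunc_resolvent_def R)
  then show ?thesis
    by (simp add: bullet_def scal_mult_left scal_sum c_def mult_ac)
qed

lemma bullet_prod_gen:
  assumes "finite A"
  shows "bullet l f (\<Prod>i\<in>A. gen (x i)) p =
    (\<Sum>i\<in>A. \<Prod>j\<in>A. if j = i then bullet l f (gen (x j)) p else gen (x j))"
  unfolding bullet_def deriv_prod[OF assms] sum_distrib_right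
proof (rule sum.cong[OF refl])
  fix i assume i: "i \<in> A"
  have "(\<Prod>j\<in>A. if j = i then deriv f (gen (x j)) * trunc_resolvent l f p else gen (x j)) =
      deriv f (gen (x i)) * trunc_resolvent l f p * (\<Prod>j\<in>A - {i}. gen (x j))"
    using i assms by (simp add: prod.remove[of A i])
  then show "deriv f (gen (x i)) * (\<Prod>j\<in>A - {i}. gen (x j)) * trunc_resolvent l f p =
      (\<Prod>j\<in>A. if j = i then deriv f (gen (x j)) * trunc_resolvent l f p else gen (x j))"
    by (simp add: mult_ac)
qed

section \<open>The coproduct on polynomials\<close>

definition coprod :: "('v multiset \<Rightarrow>\<^sub>0 'k::field) \<Rightarrow> ('v multiset \<times> 'v multiset \<Rightarrow>\<^sub>0 'k)"
  where "coprod = ext (\<lambda>m. \<Prod>v\<in>#m. tens (gen v) 1 + tens 1 (gen v))"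

lemma khom_coprod: "khom coprod"
  unfolding coprod_def by (rule khom_ext) simp_all

lemmas coprod_simps = khom_one[OF khom_coprod] khom_mult[OF khom_coprod]
  klin_add[OF khom_klin[OF khom_coprod]] klin_diff[OF khom_klin[OF khom_coprod]]
  klin_scal[OF khom_klin[OF khom_coprod]]

lemma coprod_gen: "coprod (gen v) = tens (gen v) 1 + tens 1 (gen v)"
  by (simp add: coprod_def)

lemmas tens_simps = klin_add[OF klin_tens_left] klin_add[OF klin_tens_right]
  klin_diff[OF klin_tens_left] klin_diff[OF klin_tens_right]
  klin_scal[OF klin_tens_left] klin_scal[OF klin_tens_right]
  klin_zero[OF klin_tens_left] klin_zero[OF klin_tens_right]

definition tassoc :: "(('a \<times> 'b) \<times> 'c \<Rightarrow>\<^sub>0 'k::field) \<Rightarrow> ('a \<times> 'b \<times> 'c \<Rightarrow>\<^sub>0 'k)"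
  where "tassoc = ext (\<lambda>((x, y), z). basis (x, y, z))"

lemma khom_tassoc: "khom tassoc"
proof -
  have "(1 :: 'a \<times> 'b \<times> 'c \<Rightarrow>\<^sub>0 'd) = basis (0, 0, 0)"
    by (simp flip: single_one zero_prod_def)
  then show ?thesis
    unfolding tassoc_def by (intro khom_ext) (auto simp: zero_prod_def simp flip: basis_add)
qed

lemma tassoc_tens: "tassoc (tens (tens p q) r) = tens p (tens q r)"
proof (rule klin_eqI[of "\<lambda>r. tassoc (tens (tens p q) r)" "\<lambda>r. tens p (tens q r)"])
  fix z
  show "tassoc (tens (tens p q) (basis z)) = tens p (tens q (basis z))"
    by (rule klin2_eqI[of "\<lambda>p q. tassoc (tens (tens p q) (basis z))" "\<lambda>p q. tens p (tens q (basis z))"])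
       (simp_all add: klin_intros tassoc_def)
qed (simp_all add: klin_intros tassoc_def)

text \<open>
  Both sides are algebra maps, and on an indeterminate both give the sum of its three copies.
\<close>

lemma coprod_coassoc:
  fixes p :: "'v multiset \<Rightarrow>\<^sub>0 'k::field"
  shows "tassoc (tmap coprod (\<lambda>p. p) (coprod p)) = tmap (\<lambda>p. p) coprod (coprod p)"
proof (rule khom_eqI)
  show "khom (\<lambda>p. tassoc (tmap coprod (\<lambda>p. p) (coprod p)))"
    and "khom (\<lambda>p. tmap (\<lambda>p. p) coprod (coprod p))"
    by (intro khom_comp[OF khom_tassoc] khom_comp[OF khom_tmap] khom_coprod khom_id)+
  have tassoc_1: "tassoc (tens (1 :: 'v multiset \<times> 'v multiset \<Rightarrow>\<^sub>0 'k) p) =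
      tens (1 :: 'v multiset \<Rightarrow>\<^sub>0 'k) (tens (1 :: 'v multiset \<Rightarrow>\<^sub>0 'k) p)"
    for p :: "'v multiset \<Rightarrow>\<^sub>0 'k"
    using tassoc_tens[of 1 1 p] by (simp add: tens_one)
  show "tassoc (tmap coprod (\<lambda>p. p) (coprod (gen v :: 'v multiset \<Rightarrow>\<^sub>0 'k))) = tmap (\<lambda>p. p) coprod (coprod (gen v))"
    for v :: 'v
    by (simp add: coprod_gen klin_add[OF klin_tmap] tmap_tens[OF khom_klin[OF khom_coprod] klin_id]
        tmap_tens[OF klin_id khom_klin[OF khom_coprod]] coprod_simps
        klin_add[OF khom_klin[OF khom_tassoc]] tassoc_1 tassoc_tens tens_simps add.assoc tens_one
        del: tens_basis)
qed

text \<open>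
  The maps \<open>\<epsilon> \<otimes> 1\<close> and \<open>1 \<otimes> \<epsilon>\<close> on the tensor product, with the ground field absorbed.
\<close>

definition counit_left :: "('a::zero \<times> 'b \<Rightarrow>\<^sub>0 'k::field) \<Rightarrow> ('b \<Rightarrow>\<^sub>0 'k)"
  where "counit_left = ext (\<lambda>(x, y). scal (eps (basis x)) (basis y))"

definition counit_right :: "('a \<times> 'b::zero \<Rightarrow>\<^sub>0 'k::field) \<Rightarrow> ('a \<Rightarrow>\<^sub>0 'k)"
  where "counit_right = ext (\<lambda>(x, y). scal (eps (basis y)) (basis x))"

lemma klin_counit: "klin counit_left" "klin counit_right"
  by (simp_all add: counit_left_def counit_right_def)

lemma counit_left_tens: "counit_left (tens p q) = scal (eps p) q"
  by (rule klin2_eqI[of "\<lambda>p q. counit_left (tens p q)" "\<lambda>p q. scal (eps p) q"])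
     (simp_all add: klin_tens_left klin_tens_right klin_id klin_scale klin_comp[OF klin_counit(1)]
       klin_eps, simp add: counit_left_def)

lemma counit_right_tens: "counit_right (tens p q) = scal (eps q) p"
  by (rule klin2_eqI[of "\<lambda>p q. counit_right (tens p q)" "\<lambda>p q. scal (eps q) p"])
     (simp_all add: klin_tens_left klin_tens_right klin_id klin_scale klin_comp[OF klin_counit(2)]
       klin_eps, simp add: counit_right_def)

lemma khom_counit:
  shows "khom (counit_left :: ('v multiset \<times> 'w multiset \<Rightarrow>\<^sub>0 'k::field) \<Rightarrow> _)"
    and "khom (counit_right :: ('v multiset \<times> 'w multiset \<Rightarrow>\<^sub>0 'k::field) \<Rightarrow> _)"
proof -
  have L: "counit_left (basis (m, n)) = scal (eps (basis m)) (basis n)"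
    and R: "counit_right (basis (m, n)) = scal (eps (basis n)) (basis m)"
    for m :: "'v multiset" and n :: "'w multiset"
    by (simp_all add: counit_left_def counit_right_def)
  note simps = L R eps_basis zero_prod_def scal_mult_left scal_mult_right
  show "khom (counit_left :: ('v multiset \<times> 'w multiset \<Rightarrow>\<^sub>0 'k) \<Rightarrow> _)"
    by (rule khomI[OF klin_counit(1)]) (auto simp: simps simp del: scal_single simp flip: single_one basis_add)
  show "khom (counit_right :: ('v multiset \<times> 'w multiset \<Rightarrow>\<^sub>0 'k) \<Rightarrow> _)"
    by (rule khomI[OF klin_counit(2)]) (auto simp: simps simp del: scal_single simp flip: single_one basis_add)
qed

lemma coprod_counit: "counit_left (coprod p) = p" "counit_right (coprod p) = p"
proof -
  show "counit_left (coprod p) = p"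
    by (rule khom_eqI[OF khom_comp[OF khom_counit(1) khom_coprod] khom_id])
       (simp add: coprod_gen klin_add[OF klin_counit(1)] counit_left_tens eps_basis)
  show "counit_right (coprod p) = p"
    by (rule khom_eqI[OF khom_comp[OF khom_counit(2) khom_coprod] khom_id])
       (simp add: coprod_gen klin_add[OF klin_counit(2)] counit_right_tens eps_basis)
qed

lemma tmap_deriv_mult:
  "tmap (deriv f) (\<lambda>q. q) (a * b) = tmap (deriv f) (\<lambda>q. q) a * b + a * tmap (deriv f) (\<lambda>q. q) b"
  "tmap (\<lambda>q. q) (deriv f) (a * b) = tmap (\<lambda>q. q) (deriv f) a * b + a * tmap (\<lambda>q. q) (deriv f) b"
proof -
  let ?L = "tmap (deriv f) (\<lambda>q. q)" and ?R = "tmap (\<lambda>q. q) (deriv f)"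
  have "?L (basis m * basis n) = ?L (basis m) * basis n + basis m * ?L (basis n) \<and>
      ?R (basis m * basis n) = ?R (basis m) * basis n + basis m * ?R (basis n)" for m n
  proof -
    obtain m1 m2 n1 n2 where "m = (m1, m2)" "n = (n1, n2)" by (cases m; cases n) auto
    then show ?thesis
      unfolding \<open>m = _\<close> \<open>n = _\<close> tens_basis[symmetric] tens_mult
      by (simp add: tmap_tens klin_deriv klin_id tens_mult deriv_mult tens_simps del: tens_basis)
  qed
  note * = this
  show "?L (a * b) = ?L a * b + a * ?L b"
    by (rule klin2_eqI[of "\<lambda>a b. ?L (a * b)" "\<lambda>a b. ?L a * b + a * ?L b"])
       (simp_all only: *[THEN conjunct1], (intro klin_intros)+)
  show "?R (a * b) = ?R a * b + a * ?R b"
    by (rule klin2_eqI[of "\<lambda>a b. ?R (a * b)" "\<lambda>a b. ?R a * b + a * ?R b"])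
       (simp_all only: *[THEN conjunct2], (intro klin_intros)+)
qed

text \<open>
  The three maps are derivations along \<open>coprod\<close>, and each sends the indeterminate of \<open>v\<close> to
  the constant \<open>f v\<close>.
\<close>

lemma coprod_deriv:
  "coprod (deriv f p) = tmap (deriv f) (\<lambda>q. q) (coprod p)"
  "coprod (deriv f p) = tmap (\<lambda>q. q) (deriv f) (coprod p)"
proof -
  let ?L = "tmap (deriv f) (\<lambda>q. q)" and ?R = "tmap (\<lambda>q. q) (deriv f)"
  have one: "?L 1 = 0" "?R 1 = 0"
    using tmap_tens[OF klin_deriv klin_id, of f 1 1] tmap_tens[OF klin_id klin_deriv, of f 1 1]
    by (simp_all add: tens_one tens_simps)
  have gen: "coprod (deriv f (gen v)) = ?L (coprod (gen v))" "coprod (deriv f (gen v)) = ?R (coprod (gen v))" for v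
    by (simp_all add: coprod_gen coprod_simps klin_add[OF klin_tmap] tmap_tens klin_deriv klin_id
        tens_simps tens_one)
  have kl: "klin (\<lambda>p. coprod (deriv f p))" "klin (\<lambda>p. ?L (coprod p))" "klin (\<lambda>p. ?R (coprod p))"
    by (intro klin_comp[OF khom_klin[OF khom_coprod]] klin_comp[OF klin_tmap] klin_deriv
        khom_klin[OF khom_coprod])+
  have "coprod (deriv f (basis m)) = ?L (coprod (basis m))" for m
  proof (rule basis_multiset_induct[of "\<lambda>p. coprod (deriv f p) = ?L (coprod p)"])
    fix v m assume "coprod (deriv f (basis m)) = ?L (coprod (basis m))"
    then show "coprod (deriv f (gen v * basis m)) = ?L (coprod (gen v * basis m))"
      unfolding deriv_mult coprod_simps tmap_deriv_mult gen(1) by simp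
  qed (simp add: coprod_simps one klin_zero[OF khom_klin[OF khom_coprod]])
  from klin_eqI[OF kl(1,2) this] show "coprod (deriv f p) = ?L (coprod p)" .
  have "coprod (deriv f (basis m)) = ?R (coprod (basis m))" for m
  proof (rule basis_multiset_induct[of "\<lambda>p. coprod (deriv f p) = ?R (coprod p)"])
    fix v m assume "coprod (deriv f (basis m)) = ?R (coprod (basis m))"
    then show "coprod (deriv f (gen v * basis m)) = ?R (coprod (gen v * basis m))"
      unfolding deriv_mult coprod_simps tmap_deriv_mult gen(2) by simp
  qed (simp add: coprod_simps one klin_zero[OF khom_klin[OF khom_coprod]])
  from klin_eqI[OF kl(1,3) this] show "coprod (deriv f p) = ?R (coprod p)" .
qed

text \<open>
  By \<open>coprod_deriv\<close> the coproduct intertwines \<open>1 - l d\<close> with \<open>(1 - l d) \<otimes> 1\<close>, hence also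
  the inverses of these maps.
\<close>

lemma coprod_resolvent: "coprod (resolvent l f p) = tmap (resolvent l f) (\<lambda>q. q) (coprod p)"
proof -
  define u where "u = resolvent l f p"
  have p: "p = u - scal l (deriv f u)"
    by (simp add: u_def resolvent_right)
  let ?T = "\<lambda>F. tmap F (\<lambda>q. q)"
  have *: "?T (resolvent l f) a - scal l (?T (resolvent l f) (?T (deriv f) a)) = a" for a
  proof (rule klin_eqI[of "\<lambda>a. ?T (resolvent l f) a - scal l (?T (resolvent l f) (?T (deriv f) a))" "\<lambda>a. a"])
    fix x :: "'a multiset \<times> 'c"
    have "?T (resolvent l f) (basis x) - scal l (?T (resolvent l f) (?T (deriv f) (basis x))) =
        tens (resolvent l f (basis (fst x)) - scal l (resolvent l f (deriv f (basis (fst x))))) (basis (snd x))"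
      by (cases x) (simp add: tmap_basis tmap_tens klin_resolvent klin_id tens_simps)
    then show "?T (resolvent l f) (basis x) - scal l (?T (resolvent l f) (?T (deriv f) (basis x))) = basis x"
      by (simp add: resolvent_left)
  qed (simp_all add: klin_intros)
  have "tmap (resolvent l f) (\<lambda>q. q) (coprod p) = coprod u"
    unfolding p coprod_simps coprod_deriv(1)
    by (simp add: klin_diff[OF klin_tmap] klin_scal[OF klin_tmap] *)
  then show ?thesis by (simp add: u_def)
qed

text \<open>
  Truncating the left factor subtracts \<open>1 \<otimes> (\<epsilon> \<otimes> 1)\<close> of the untruncated expression, which
  is the coproduct of \<open>resolvent l f p\<close>. The counit law turns this correction into
  \<open>1 \<otimes> resolvent l f p\<close>, and the constant terms on both sides agree.
\<close>

lemma coprod_trunc_resolvent: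
  "coprod (trunc_resolvent l f p) =
    tens 1 (trunc_resolvent l f p) + tmap (trunc_resolvent l f) (\<lambda>q. q) (coprod p)"
proof -
  let ?T = "\<lambda>F. tmap F (\<lambda>q. q)"
  have *: "?T (trunc_resolvent l f) a = ?T (resolvent l f) a - tens 1 (counit_left (?T (resolvent l f) a))"
    for a :: "'a multiset \<times> 'a multiset \<Rightarrow>\<^sub>0 'b"
  proof (rule klin_eqI[of _ "\<lambda>a. ?T (resolvent l f) a - tens 1 (counit_left (?T (resolvent l f) a))"])
    fix x :: "'a multiset \<times> 'a multiset"
    show "?T (trunc_resolvent l f) (basis x) =
        ?T (resolvent l f) (basis x) - tens 1 (counit_left (?T (resolvent l f) (basis x)))"
      by (cases x) (simp add: tmap_basis counit_left_tens trunc_resolvent_def tens_simps del: scal_single)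
  qed (simp_all add: klin_intros klin_comp[OF klin_counit(1)])
  show ?thesis
    unfolding * coprod_resolvent[symmetric] coprod_counit
    by (simp add: trunc_resolvent_def coprod_simps tens_simps tens_one)
qed

text \<open>
  The coproduct of \<open>d p\<close> is multiplied by the two summands of \<open>coprod_trunc_resolvent\<close>: in
  front of the first it is written with \<open>1 \<otimes> d\<close>, in front of the second with \<open>d \<otimes> 1\<close>.
\<close>

lemma coprod_bullet:
  "coprod (bullet l f p q) =
    tmap (\<lambda>r. r) (\<lambda>r. bullet l f r q) (coprod p) +
    tmap (deriv f) (\<lambda>r. r) (coprod p) * tmap (trunc_resolvent l f) (\<lambda>r. r) (coprod q)"
proof -
  have "tmap (\<lambda>r. r) (\<lambda>r. bullet l f r q) a = tmap (\<lambda>r. r) (deriv f) a * tens 1 (trunc_resolvent l f q)"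
    for a :: "'a multiset \<times> 'a multiset \<Rightarrow>\<^sub>0 'b"
    by (rule klin_eqI[of _ "\<lambda>a. tmap (\<lambda>r. r) (deriv f) a * tens 1 (trunc_resolvent l f q)"])
       (auto simp: klin_intros tmap_basis bullet_def tens_mult)
  then show ?thesis
    by (simp add: bullet_def coprod_simps coprod_trunc_resolvent distrib_left
        flip: coprod_deriv)
qed

section \<open>Linear maps into modules\<close>

abbreviation kmod :: "('k::field, 'c) module \<Rightarrow> bool"
  where "kmod C \<equiv> Module.module ring_of_type_algebra C"

lemma ring_of_type_algebra_simps [simp]:
  "carrier ring_of_type_algebra = UNIV" "zero ring_of_type_algebra = 0"
  "one ring_of_type_algebra = 1" "add ring_of_type_algebra = (+)"
  "monoid.mult ring_of_type_algebra = (*)"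
  by (simp_all add: ring_of_type_algebra_def)

lemma kmod_smult_closed: "kmod C \<Longrightarrow> x \<in> carrier C \<Longrightarrow> c \<odot>\<^bsub>C\<^esub> x \<in> carrier C"
  and kmod_smult_add_left: "kmod C \<Longrightarrow> x \<in> carrier C \<Longrightarrow> (c + d) \<odot>\<^bsub>C\<^esub> x = c \<odot>\<^bsub>C\<^esub> x \<oplus>\<^bsub>C\<^esub> d \<odot>\<^bsub>C\<^esub> x"
  and kmod_smult_add_right: "kmod C \<Longrightarrow> x \<in> carrier C \<Longrightarrow> y \<in> carrier C \<Longrightarrow>
    c \<odot>\<^bsub>C\<^esub> (x \<oplus>\<^bsub>C\<^esub> y) = c \<odot>\<^bsub>C\<^esub> x \<oplus>\<^bsub>C\<^esub> c \<odot>\<^bsub>C\<^esub> y"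
  and kmod_smult_assoc: "kmod C \<Longrightarrow> x \<in> carrier C \<Longrightarrow> (c * d) \<odot>\<^bsub>C\<^esub> x = c \<odot>\<^bsub>C\<^esub> (d \<odot>\<^bsub>C\<^esub> x)"
  and kmod_smult_one: "kmod C \<Longrightarrow> x \<in> carrier C \<Longrightarrow> 1 \<odot>\<^bsub>C\<^esub> x = x"
  and kmod_smult_zero: "kmod C \<Longrightarrow> x \<in> carrier C \<Longrightarrow> 0 \<odot>\<^bsub>C\<^esub> x = \<zero>\<^bsub>C\<^esub>"
  and kmod_smult_zero_right: "kmod C \<Longrightarrow> c \<odot>\<^bsub>C\<^esub> \<zero>\<^bsub>C\<^esub> = \<zero>\<^bsub>C\<^esub>"
  for C :: "('k::field, 'c) module"
  using module.smult_closed[of ring_of_type_algebra C c x]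
    module.smult_l_distr[of ring_of_type_algebra C c d x]
    module.smult_r_distr[of ring_of_type_algebra C c x y]
    module.smult_assoc1[of ring_of_type_algebra C c d x]
    module.smult_one[of ring_of_type_algebra C x]
    module.smult_l_null[of ring_of_type_algebra C x]
    module.smult_r_null[of ring_of_type_algebra C c]
  by simp_all

lemma kmod_abelian_group: "kmod C \<Longrightarrow> abelian_group C"
  by (simp add: module_def)

lemma kmodI:
  fixes C :: "('k::field, 'c) module"
  assumes "abelian_group C"
    and "\<And>c x. x \<in> carrier C \<Longrightarrow> c \<odot>\<^bsub>C\<^esub> x \<in> carrier C"
    and "\<And>c d x. x \<in> carrier C \<Longrightarrow> (c + d) \<odot>\<^bsub>C\<^esub> x = c \<odot>\<^bsub>C\<^esub> x \<oplus>\<^bsub>C\<^esub> d \<odot>\<^bsub>C\<^esub> x"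
    and "\<And>c x y. x \<in> carrier C \<Longrightarrow> y \<in> carrier C \<Longrightarrow>
      c \<odot>\<^bsub>C\<^esub> (x \<oplus>\<^bsub>C\<^esub> y) = c \<odot>\<^bsub>C\<^esub> x \<oplus>\<^bsub>C\<^esub> c \<odot>\<^bsub>C\<^esub> y"
    and "\<And>c d x. x \<in> carrier C \<Longrightarrow> (c * d) \<odot>\<^bsub>C\<^esub> x = c \<odot>\<^bsub>C\<^esub> (d \<odot>\<^bsub>C\<^esub> x)"
    and "\<And>x. x \<in> carrier C \<Longrightarrow> 1 \<odot>\<^bsub>C\<^esub> x = x"
  shows "kmod C"
  by (rule moduleI[OF cring_from_type_algebra]) (use assms in simp_all)

text \<open>
  The counterpart of \<open>klin\<close> for maps whose target is a module given as a record.
\<close>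

definition clin :: "('k::field, 'c) module \<Rightarrow> (('a \<Rightarrow>\<^sub>0 'k) \<Rightarrow> 'c) \<Rightarrow> bool"
  where "clin C F \<longleftrightarrow> (\<forall>p. F p \<in> carrier C) \<and> (\<forall>p q. F (p + q) = F p \<oplus>\<^bsub>C\<^esub> F q) \<and>
    (\<forall>c p. F (scal c p) = c \<odot>\<^bsub>C\<^esub> F p)"

lemma clinI: "(\<And>p. F p \<in> carrier C) \<Longrightarrow> (\<And>p q. F (p + q) = F p \<oplus>\<^bsub>C\<^esub> F q) \<Longrightarrow>
    (\<And>c p. F (scal c p) = c \<odot>\<^bsub>C\<^esub> F p) \<Longrightarrow> clin C F"
  and clin_closed: "clin C F \<Longrightarrow> F p \<in> carrier C"
  and clin_add: "clin C F \<Longrightarrow> F (p + q) = F p \<oplus>\<^bsub>C\<^esub> F q"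
  and clin_scal: "clin C F \<Longrightarrow> F (scal c p) = c \<odot>\<^bsub>C\<^esub> F p"
  by (simp_all add: clin_def)

lemma clin_comp: "clin C F \<Longrightarrow> klin G \<Longrightarrow> clin C (\<lambda>p. F (G p))"
  by (simp add: clin_def klin_add klin_scal)

lemma clin_zero: "kmod C \<Longrightarrow> clin C F \<Longrightarrow> F 0 = \<zero>\<^bsub>C\<^esub>"
  using clin_scal[of C F 0 0] by (simp add: kmod_smult_zero clin_closed)

lemma clin_diff:
  assumes "kmod C" "clin C F"
  shows "F (p - q) = F p \<ominus>\<^bsub>C\<^esub> F q"
proof -
  interpret abelian_group C using assms(1) by (rule kmod_abelian_group)
  have "F p = F (p - q) \<oplus>\<^bsub>C\<^esub> F q"
    using clin_add[OF assms(2), of "p - q" q] by simp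
  moreover have "F (p - q) \<in> carrier C" "F q \<in> carrier C"
    using assms(2) by (auto intro: clin_closed)
  ultimately show ?thesis
    by (simp add: a_minus_def a_assoc r_neg)
qed

lemma clin_sum:
  assumes "kmod C" "clin C F" "finite A"
  shows "F (\<Sum>i\<in>A. g i) = (\<Oplus>\<^bsub>C\<^esub>i\<in>A. F (g i))"
proof -
  interpret abelian_group C using assms(1) by (rule kmod_abelian_group)
  show ?thesis
    using assms(3) by (induction A rule: finite_induct)
      (use assms in \<open>simp_all add: clin_zero clin_add clin_closed Pi_def\<close>)
qed

lemma clin_eqI:
  assumes "kmod C" "clin C F" "clin C G" "\<And>x. F (basis x) = G (basis x)"
  shows "F p = G p"
proof (induction p rule: poly_mapping_linear_induct)
  case zero
  then show ?case using assms by (simp add: clin_zero)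
next
  case (add p q)
  then show ?case by (simp add: clin_add[OF assms(2)] clin_add[OF assms(3)])
next
  case (scal c p)
  then show ?case by (simp add: clin_scal[OF assms(2)] clin_scal[OF assms(3)])
qed (rule assms(4))

lemma clin2_eqI:
  assumes "kmod C" "\<And>q. clin C (\<lambda>p. F p q)" "\<And>p. clin C (F p)"
    and "\<And>q. clin C (\<lambda>p. G p q)" "\<And>p. clin C (G p)"
    and "\<And>x y. F (basis x) (basis y) = G (basis x) (basis y)"
  shows "F p q = G p q"
proof (rule clin_eqI[of C "\<lambda>p. F p q" "\<lambda>p. G p q"])
  show "F (basis x) q = G (basis x) q" for x
    by (rule clin_eqI[of C "F (basis x)" "G (basis x)"]) (rule assms)+
qed (rule assms)+

text \<open>
  The sum that defines a Sweedler expression, taken at a fixed representative \<open>p\<close>.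
\<close>

definition lin :: "('k::field, 'c) module \<Rightarrow> ('a \<Rightarrow> 'c) \<Rightarrow> ('a \<Rightarrow>\<^sub>0 'k) \<Rightarrow> 'c"
  where "lin C g p = (\<Oplus>\<^bsub>C\<^esub>x\<in>Poly_Mapping.keys p. Poly_Mapping.lookup p x \<odot>\<^bsub>C\<^esub> g x)"

lemma clin_lin:
  fixes C :: "('k::field, 'c) module" and g :: "'b \<Rightarrow> 'c"
  assumes C: "kmod C" and g: "\<And>x. g x \<in> carrier C"
  shows "clin C (lin C g)"
proof -
  interpret abelian_group C using C by (rule kmod_abelian_group)
  have sm: "c \<odot>\<^bsub>C\<^esub> g x \<in> carrier C" for c x
    by (rule kmod_smult_closed[OF C g])
  have sup: "lin C g p = (\<Oplus>\<^bsub>C\<^esub>x\<in>A. Poly_Mapping.lookup p x \<odot>\<^bsub>C\<^esub> g x)"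
    if "finite A" "Poly_Mapping.keys p \<subseteq> A" for p A
    unfolding lin_def using that
    by (intro add.finprod_mono_neutral_cong_left)
      (auto simp: sm in_keys_iff kmod_smult_zero[OF C g])
  show ?thesis
  proof (rule clinI)
    fix p q :: "'b \<Rightarrow>\<^sub>0 'k" and c :: 'k
    show "lin C g p \<in> carrier C"
      unfolding lin_def by (rule finsum_closed) (simp add: sm)
    let ?A = "Poly_Mapping.keys p \<union> Poly_Mapping.keys q"
    have "Poly_Mapping.keys (p + q) \<subseteq> ?A" by (rule Poly_Mapping.keys_add)
    then show "lin C g (p + q) = lin C g p \<oplus>\<^bsub>C\<^esub> lin C g q"
      by (simp add: sup[of ?A] lookup_add kmod_smult_add_left[OF C g] finsum_addf sm)
    have k: "Poly_Mapping.keys (scal c p) \<subseteq> Poly_Mapping.keys p"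
      by (auto simp: in_keys_iff)
    have "c \<odot>\<^bsub>C\<^esub> (\<Oplus>\<^bsub>C\<^esub>x\<in>A. Poly_Mapping.lookup p x \<odot>\<^bsub>C\<^esub> g x) =
        (\<Oplus>\<^bsub>C\<^esub>x\<in>A. c \<odot>\<^bsub>C\<^esub> (Poly_Mapping.lookup p x \<odot>\<^bsub>C\<^esub> g x))" if "finite A" for A
      using that by (induction A rule: finite_induct)
        (simp_all add: kmod_smult_zero_right[OF C] kmod_smult_add_right[OF C] sm Pi_def
          kmod_smult_closed[OF C])
    then show "lin C g (scal c p) = c \<odot>\<^bsub>C\<^esub> lin C g p"
      using k by (simp add: sup[of "Poly_Mapping.keys p"] kmod_smult_assoc[OF C g])
  qed
qed

lemma lin_basis:
  assumes "kmod C" "\<And>x. g x \<in> carrier C"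
  shows "lin C g (basis x) = g x"
proof -
  interpret abelian_group C using assms(1) by (rule kmod_abelian_group)
  show ?thesis
    using assms by (simp add: lin_def kmod_smult_one kmod_smult_closed)
qed

section \<open>Quotients of spaces of finitely supported functions\<close>

text \<open>
  The axioms are inherited along a surjection from a subspace of a free vector space. The
  carrier of \<open>free_tensor A B\<close> is in general a proper subspace of its type.
\<close>

lemma kmod_imageI:
  fixes C :: "('k::field, 'c) module" and U :: "('a \<Rightarrow>\<^sub>0 'k) set"
  assumes car: "carrier C = h ` U" and zero: "\<zero>\<^bsub>C\<^esub> = h 0"
    and add: "\<And>p q. p \<in> U \<Longrightarrow> q \<in> U \<Longrightarrow> h p \<oplus>\<^bsub>C\<^esub> h q = h (p + q)"
    and smult: "\<And>c p. p \<in> U \<Longrightarrow> c \<odot>\<^bsub>C\<^esub> h p = h (scal c p)"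
    and U: "0 \<in> U" "\<And>p q. p \<in> U \<Longrightarrow> q \<in> U \<Longrightarrow> p + q \<in> U" "\<And>c p. p \<in> U \<Longrightarrow> scal c p \<in> U"
  shows "kmod C"
proof -
  have "abelian_group C"
  proof (rule abelian_groupI)
    fix x assume "x \<in> carrier C"
    then obtain p where p: "x = h p" "p \<in> U" using car by auto
    have "scal (- 1) p + p = 0" by (simp add: scal_minus_one)
    then have "h (scal (- 1) p) \<oplus>\<^bsub>C\<^esub> x = \<zero>\<^bsub>C\<^esub>"
      using p U by (simp add: add zero)
    moreover have "h (scal (- 1) p) \<in> carrier C"
      using p U car by auto
    ultimately show "\<exists>y\<in>carrier C. y \<oplus>\<^bsub>C\<^esub> x = \<zero>\<^bsub>C\<^esub>" by blast
  qed (auto simp: car add zero U add_ac)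
  then show ?thesis
    by (rule kmodI)
       (auto simp: car add smult U scal_add_left scal_add_right)
qed

definition subspace_of :: "('a \<Rightarrow>\<^sub>0 'k::field) set \<Rightarrow> bool"
  where "subspace_of U \<longleftrightarrow> 0 \<in> U \<and> (\<forall>p\<in>U. \<forall>q\<in>U. p + q \<in> U) \<and> (\<forall>c. \<forall>p\<in>U. scal c p \<in> U)"

lemma subspace_ofD:
  assumes "subspace_of U"
  shows "0 \<in> U" "\<And>p q. p \<in> U \<Longrightarrow> q \<in> U \<Longrightarrow> p + q \<in> U" "\<And>c p. p \<in> U \<Longrightarrow> scal c p \<in> U"
    "\<And>p. p \<in> U \<Longrightarrow> - p \<in> U" "\<And>p q. p \<in> U \<Longrightarrow> q \<in> U \<Longrightarrow> p - q \<in> U"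
proof -
  show *: "0 \<in> U" "\<And>p q. p \<in> U \<Longrightarrow> q \<in> U \<Longrightarrow> p + q \<in> U" "\<And>c p. p \<in> U \<Longrightarrow> scal c p \<in> U"
    using assms by (auto simp: subspace_of_def)
  show **: "- p \<in> U" if "p \<in> U" for p
    using *(3)[OF that, of "- 1"] by (simp add: scal_minus_one)
  show "p - q \<in> U" if "p \<in> U" "q \<in> U" for p q
    using *(2)[OF that(1) **[OF that(2)]] by simp
qed

text \<open>
  The additive coset of \<open>J\<close> through \<open>p\<close>, written with the operations of the type.
\<close>

definition coset :: "('a \<Rightarrow>\<^sub>0 'k::field) set \<Rightarrow> ('a \<Rightarrow>\<^sub>0 'k) \<Rightarrow> ('a \<Rightarrow>\<^sub>0 'k) set"
  where "coset J p = (\<lambda>j. j + p) ` J"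

lemma mem_coset_iff: "q \<in> coset J p \<longleftrightarrow> q - p \<in> J"
  by (auto simp: coset_def image_iff intro: bexI[of _ "q - p"])

lemma coset_eq_iff:
  assumes J: "subspace_of J"
  shows "coset J p = coset J q \<longleftrightarrow> p - q \<in> J"
proof
  assume "coset J p = coset J q"
  moreover have "p \<in> coset J p" using subspace_ofD(1)[OF J] by (simp add: mem_coset_iff)
  ultimately show "p - q \<in> J" by (simp add: mem_coset_iff)
next
  assume pq: "p - q \<in> J"
  have "r - p \<in> J \<longleftrightarrow> r - q \<in> J" for r
    using subspace_ofD(2)[OF J, of "r - p" "p - q"] subspace_ofD(5)[OF J, of "r - q" "p - q"] pq
    by auto
  then show "coset J p = coset J q" by (auto simp: mem_coset_iff)
qed

lemma
  fixes R :: "('k::field, 'a \<Rightarrow>\<^sub>0 'k) module"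
  assumes add: "add R = (+)" and J: "subspace_of J"
  shows quotient_coset: "J +>\<^bsub>R\<^esub> p = coset J p"
    and quotient_carrier: "carrier (quotient_algebra R J) = coset J ` carrier R"
    and quotient_add: "coset J p \<oplus>\<^bsub>quotient_algebra R J\<^esub> coset J q = coset J (p + q)"
    and quotient_zero: "\<zero>\<^bsub>quotient_algebra R J\<^esub> = coset J 0"
    and quotient_one: "\<one>\<^bsub>quotient_algebra R J\<^esub> = coset J \<one>\<^bsub>R\<^esub>"
    and quotient_smult: "module.smult R = scal \<Longrightarrow> c \<odot>\<^bsub>quotient_algebra R J\<^esub> coset J p = coset J (scal c p)"
proof -
  show cos: "J +>\<^bsub>R\<^esub> p = coset J p" for p
    by (auto simp: a_r_coset_def' add coset_def)
  show "carrier (quotient_algebra R J) = coset J ` carrier R"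
    by (auto simp: quotient_algebra_def ring.defs module.defs FactRing_def A_RCOSETS_def' cos)
  have "coset J p <+>\<^bsub>R\<^esub> coset J q = coset J (p + q)"
  proof (rule Set.set_eqI)
    fix r
    have "r \<in> coset J p <+>\<^bsub>R\<^esub> coset J q \<longleftrightarrow> (\<exists>j\<in>J. \<exists>k\<in>J. r = (j + p) + (k + q))"
      by (auto simp: set_add_def' add coset_def)
    also have "\<dots> \<longleftrightarrow> (\<exists>j\<in>J. \<exists>k\<in>J. r - (p + q) = j + k)"
      by (intro bex_cong refl) (auto simp: algebra_simps)
    also have "\<dots> \<longleftrightarrow> r - (p + q) \<in> J"
      using subspace_ofD(1,2)[OF J] by (auto intro: bexI[of _ 0])
    finally show "r \<in> coset J p <+>\<^bsub>R\<^esub> coset J q \<longleftrightarrow> r \<in> coset J (p + q)"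
      by (simp add: mem_coset_iff)
  qed
  then show "coset J p \<oplus>\<^bsub>quotient_algebra R J\<^esub> coset J q = coset J (p + q)"
    by (simp add: quotient_algebra_def ring.defs module.defs FactRing_def)
  have "coset J 0 = J" by (auto simp: coset_def)
  then show "\<zero>\<^bsub>quotient_algebra R J\<^esub> = coset J 0"
    by (simp add: quotient_algebra_def ring.defs module.defs FactRing_def)
  show "\<one>\<^bsub>quotient_algebra R J\<^esub> = coset J \<one>\<^bsub>R\<^esub>"
    by (simp add: quotient_algebra_def ring.defs module.defs FactRing_def cos)
  assume smult: "module.smult R = scal"
  have "(\<Union>y\<in>coset J p. coset J (scal c y)) = coset J (scal c p)"
  proof -
    have "coset J (scal c y) = coset J (scal c p)" if "y \<in> coset J p" for y
      using subspace_ofD(3)[OF J, of "y - p" c] that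
      by (simp add: mem_coset_iff coset_eq_iff[OF J] scal_diff_right)
    moreover have "p \<in> coset J p" using subspace_ofD(1)[OF J] by (simp add: mem_coset_iff)
    ultimately show ?thesis by blast
  qed
  then show "c \<odot>\<^bsub>quotient_algebra R J\<^esub> coset J p = coset J (scal c p)"
    by (simp add: quotient_algebra_def ring.defs module.defs cos smult)
qed

text \<open>
  Absorption is asked at the given representatives only, because the kernel of a tensor product
  absorbs just the elements that are supported on the carriers.
\<close>

lemma quotient_mult:
  fixes R :: "('k::field, 'a \<Rightarrow>\<^sub>0 'k) module"
  assumes add: "add R = (+)" and J: "subspace_of J"
    and absorb: "\<And>j k. j \<in> J \<Longrightarrow> k \<in> J \<Longrightarrow> (j + p) \<otimes>\<^bsub>R\<^esub> (k + q) - p \<otimes>\<^bsub>R\<^esub> q \<in> J"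
  shows "coset J p \<otimes>\<^bsub>quotient_algebra R J\<^esub> coset J q = coset J (p \<otimes>\<^bsub>R\<^esub> q)"
proof -
  have "coset J (a \<otimes>\<^bsub>R\<^esub> b) = coset J (p \<otimes>\<^bsub>R\<^esub> q)" if "a \<in> coset J p" "b \<in> coset J q" for a b
    unfolding coset_eq_iff[OF J]
    using that absorb[of "a - p" "b - q"] by (simp add: mem_coset_iff)
  moreover have "p \<in> coset J p" "q \<in> coset J q"
    using subspace_ofD(1)[OF J] by (simp_all add: mem_coset_iff)
  ultimately have "(\<Union>a\<in>coset J p. \<Union>b\<in>coset J q. coset J (a \<otimes>\<^bsub>R\<^esub> b)) = coset J (p \<otimes>\<^bsub>R\<^esub> q)"
    by blast
  then show ?thesis
    by (simp add: quotient_algebra_def ring.defs module.defs FactRing_def rcoset_mult_def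
        quotient_coset[OF add J])
qed

lemma kmod_quotient:
  fixes R :: "('k::field, 'a \<Rightarrow>\<^sub>0 'k) module"
  assumes "add R = (+)" "module.smult R = scal" "subspace_of J" "subspace_of (carrier R)"
  shows "kmod (quotient_algebra R J)"
  by (rule kmod_imageI[of _ "coset J" "carrier R"])
     (use assms in \<open>simp_all add: quotient_carrier quotient_zero quotient_add quotient_smult subspace_ofD\<close>)

section \<open>Tensor products\<close>

lemma bilinear_mapD:
  assumes "bilinear_map A B C g"
  shows "a \<in> carrier A \<Longrightarrow> b \<in> carrier B \<Longrightarrow> g a b \<in> carrier C"
    and "a \<in> carrier A \<Longrightarrow> a' \<in> carrier A \<Longrightarrow> b \<in> carrier B \<Longrightarrow>
      g (a \<oplus>\<^bsub>A\<^esub> a') b = g a b \<oplus>\<^bsub>C\<^esub> g a' b"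
    and "a \<in> carrier A \<Longrightarrow> b \<in> carrier B \<Longrightarrow> b' \<in> carrier B \<Longrightarrow>
      g a (b \<oplus>\<^bsub>B\<^esub> b') = g a b \<oplus>\<^bsub>C\<^esub> g a b'"
    and "a \<in> carrier A \<Longrightarrow> b \<in> carrier B \<Longrightarrow> g (c \<odot>\<^bsub>A\<^esub> a) b = c \<odot>\<^bsub>C\<^esub> g a b"
    and "a \<in> carrier A \<Longrightarrow> b \<in> carrier B \<Longrightarrow> g a (c \<odot>\<^bsub>B\<^esub> b) = c \<odot>\<^bsub>C\<^esub> g a b"
  using assms by (auto simp: bilinear_map_def)

lemma module_scal: "Modules.module (scal :: 'k::field \<Rightarrow> ('a \<Rightarrow>\<^sub>0 'k) \<Rightarrow> _)"
  by unfold_locales (simp_all add: scal_add_right scal_add_left)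

lemma free_tensor_simps [simp]:
  "carrier (free_tensor A B) = {p. Poly_Mapping.keys p \<subseteq> carrier A \<times> carrier B}"
  "add (free_tensor A B) = (+)" "module.smult (free_tensor A B) = scal"
  "\<one>\<^bsub>free_tensor A B\<^esub> = basis (\<one>\<^bsub>A\<^esub>, \<one>\<^bsub>B\<^esub>)"
  by (simp_all add: free_tensor_def scal_def fun_eq_iff)

lemma keys_scal_subset: "Poly_Mapping.keys (scal c p) \<subseteq> Poly_Mapping.keys p"
  by (auto simp: in_keys_iff)

lemma subspace_keys: "subspace_of {p. Poly_Mapping.keys p \<subseteq> U}"
  unfolding subspace_of_def
  using keys_scal_subset Poly_Mapping.keys_add by (fastforce simp: subset_iff)

lemma tensor_kernel_eq: "tensor_kernel A B = Modules.module.span scal (tensor_relations A B)"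
  by (simp add: tensor_kernel_def scal_def[abs_def])

lemma subspace_span: "subspace_of (Modules.module.span scal S)"
  unfolding subspace_of_def
  by (simp add: module.span_zero[OF module_scal] module.span_add[OF module_scal]
      module.span_scale[OF module_scal])

lemma subspace_tensor_kernel: "subspace_of (tensor_kernel A B)"
  unfolding tensor_kernel_eq by (rule subspace_span)

lemma tensor_relations_kernel: "r \<in> tensor_relations A B \<Longrightarrow> r \<in> tensor_kernel A B"
  unfolding tensor_kernel_eq by (rule module.span_base[OF module_scal])

lemma tensor_kernel_induct [consumes 1, case_names zero step]:
  assumes "p \<in> tensor_kernel A B" "P 0"
    and "\<And>c r q. r \<in> tensor_relations A B \<Longrightarrow> P q \<Longrightarrow> P (scal c r + q)"
  shows "P p"
  using assms(1) unfolding tensor_kernel_eq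
  by (rule module.span_induct_alt[OF module_scal]) (fact assms(2,3))+

lemma tensor_relations_cases [consumes 1, case_names add_left add_right smult_left smult_right]:
  assumes "r \<in> tensor_relations A B"
  obtains a a' b where "a \<in> carrier A" "a' \<in> carrier A" "b \<in> carrier B"
      "r = basis (a \<oplus>\<^bsub>A\<^esub> a', b) - basis (a, b) - basis (a', b)"
    | a b b' where "a \<in> carrier A" "b \<in> carrier B" "b' \<in> carrier B"
      "r = basis (a, b \<oplus>\<^bsub>B\<^esub> b') - basis (a, b) - basis (a, b')"
    | c a b where "a \<in> carrier A" "b \<in> carrier B"
      "r = basis (c \<odot>\<^bsub>A\<^esub> a, b) - scal c (basis (a, b))"
    | c a b where "a \<in> carrier A" "b \<in> carrier B"
      "r = basis (a, c \<odot>\<^bsub>B\<^esub> b) - scal c (basis (a, b))"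
  using assms unfolding tensor_relations_def by fastforce

lemma tensor_relationsI:
  "a \<in> carrier A \<Longrightarrow> a' \<in> carrier A \<Longrightarrow> b \<in> carrier B \<Longrightarrow>
    basis (a \<oplus>\<^bsub>A\<^esub> a', b) - basis (a, b) - basis (a', b) \<in> tensor_relations A B"
  "a \<in> carrier A \<Longrightarrow> b \<in> carrier B \<Longrightarrow> b' \<in> carrier B \<Longrightarrow>
    basis (a, b \<oplus>\<^bsub>B\<^esub> b') - basis (a, b) - basis (a, b') \<in> tensor_relations A B"
  "a \<in> carrier A \<Longrightarrow> b \<in> carrier B \<Longrightarrow>
    basis (c \<odot>\<^bsub>A\<^esub> a, b) - scal c (basis (a, b)) \<in> tensor_relations A B"
  "a \<in> carrier A \<Longrightarrow> b \<in> carrier B \<Longrightarrow>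
    basis (a, c \<odot>\<^bsub>B\<^esub> b) - scal c (basis (a, b)) \<in> tensor_relations A B"
  unfolding tensor_relations_def by auto

lemma kmod_add_closed:
  "kmod A \<Longrightarrow> a \<in> carrier A \<Longrightarrow> a' \<in> carrier A \<Longrightarrow> a \<oplus>\<^bsub>A\<^esub> a' \<in> carrier A"
  using abelian_monoid.a_closed[OF abelian_group.axioms(1)[OF kmod_abelian_group]] .

lemma tensor_kernel_carrier:
  assumes "kmod A" "kmod B"
  shows "tensor_kernel A B \<subseteq> carrier (free_tensor A B)"
proof
  fix p assume "p \<in> tensor_kernel A B"
  then show "p \<in> carrier (free_tensor A B)"
  proof (induction p rule: tensor_kernel_induct)
    case zero
    then show ?case by simp
  next
    case (step c r q)
    note sub = subspace_keys[of "carrier A \<times> carrier B"]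
    have b: "basis (a, b) \<in> {p. Poly_Mapping.keys p \<subseteq> carrier A \<times> carrier B}"
      if "a \<in> carrier A" "b \<in> carrier B" for a b using that by simp
    have "r \<in> {p. Poly_Mapping.keys p \<subseteq> carrier A \<times> carrier B}"
      using step(1)
      by (cases rule: tensor_relations_cases; simp only:;
          intro subspace_ofD[OF sub] b kmod_add_closed[OF assms(1)]
            kmod_add_closed[OF assms(2)] kmod_smult_closed[OF assms(1)]
            kmod_smult_closed[OF assms(2)])
    then have "scal c r + q \<in> {p. Poly_Mapping.keys p \<subseteq> carrier A \<times> carrier B}"
      by (intro subspace_ofD(2,3)[OF sub]) (use step(2) in simp_all)
    then show ?case by simp
  qed
qed

lemma
  shows tensor_carrier: "carrier (tensor A B) = coset (tensor_kernel A B) ` carrier (free_tensor A B)"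
    and tensor_add: "coset (tensor_kernel A B) p \<oplus>\<^bsub>tensor A B\<^esub> coset (tensor_kernel A B) q =
      coset (tensor_kernel A B) (p + q)"
    and tensor_smult: "c \<odot>\<^bsub>tensor A B\<^esub> coset (tensor_kernel A B) p = coset (tensor_kernel A B) (scal c p)"
    and pure_tensor_eq: "pure_tensor A B a b = coset (tensor_kernel A B) (basis (a, b))"
  unfolding tensor_def pure_tensor_def
  by (simp_all only: quotient_carrier quotient_add quotient_smult quotient_coset
      free_tensor_simps(2,3) subspace_tensor_kernel)

lemma kmod_tensor: "kmod (tensor A B)"
  unfolding tensor_def
  by (rule kmod_quotient) (simp_all add: subspace_tensor_kernel subspace_keys)

lemma bilinear_pure_tensor: "bilinear_map A B (tensor A B) (pure_tensor A B)"
  unfolding bilinear_map_def pure_tensor_eq tensor_add tensor_smult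
    coset_eq_iff[OF subspace_tensor_kernel] diff_diff_eq[symmetric]
  by (auto simp: tensor_carrier diff_diff_eq2[symmetric] simp del: scal_single
      intro!: tensor_relations_kernel tensor_relationsI)

text \<open>
  Outside the carriers \<open>g\<close> is replaced by \<open>0\<close>, which makes its linear extension a linear map on
  the whole free vector space. Bilinearity means that this map vanishes on the relations, hence on
  the kernel, so that the representative chosen by \<open>sweedler\<close> may be exchanged for \<open>p\<close>.
\<close>

lemma sweedler_coset:
  fixes C :: "('k::field, 'c) module"
  assumes A: "kmod A" and B: "kmod B" and C: "kmod C" and g: "bilinear_map A B C g"
    and p: "p \<in> carrier (free_tensor A B)"
  shows "sweedler C g (coset (tensor_kernel A B) p) =
    lin C (\<lambda>(a, b). if a \<in> carrier A \<and> b \<in> carrier B then g a b else \<zero>\<^bsub>C\<^esub>) p"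
proof -
  define h where "h x = (if fst x \<in> carrier A \<and> snd x \<in> carrier B then g (fst x) (snd x) else \<zero>\<^bsub>C\<^esub>)" for x
  interpret C: abelian_group C using C by (rule kmod_abelian_group)
  have h: "h x \<in> carrier C" for x
    using bilinear_mapD(1)[OF g] by (simp add: h_def)
  note L = clin_lin[of C h, OF C h]
  have hg: "lin C h (basis (a, b)) = g a b" if "a \<in> carrier A" "b \<in> carrier B" for a b
    using lin_basis[of C h "(a, b)", OF C h] that by (simp add: h_def)
  have ker: "lin C h q = \<zero>\<^bsub>C\<^esub>" if "q \<in> tensor_kernel A B" for q
    using that
  proof (induction q rule: tensor_kernel_induct)
    case zero
    then show ?case by (rule clin_zero[OF C L])
  next
    case (step c r q)
    note cl = kmod_add_closed[OF A] kmod_add_closed[OF B]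
      kmod_smult_closed[OF A] kmod_smult_closed[OF B] bilinear_mapD(1)[OF g]
      kmod_smult_closed[OF C]
    have "lin C h r = \<zero>\<^bsub>C\<^esub>"
      using step(1)
    proof (cases rule: tensor_relations_cases)
      case (add_left a a' b)
      then show ?thesis
        by (simp add: diff_diff_eq clin_diff[OF C L] clin_add[OF L] hg cl bilinear_mapD(2)[OF g]
            a_minus_def C.r_neg)
    next
      case (add_right a b b')
      then show ?thesis
        by (simp add: diff_diff_eq clin_diff[OF C L] clin_add[OF L] hg cl bilinear_mapD(3)[OF g]
            a_minus_def C.r_neg)
    next
      case (smult_left c a b)
      then show ?thesis
        by (simp add: clin_diff[OF C L] hg cl bilinear_mapD(4)[OF g] a_minus_def C.r_neg
            clin_scal[OF L] del: scal_single)
    next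
      case (smult_right c a b)
      then show ?thesis
        by (simp add: clin_diff[OF C L] hg cl bilinear_mapD(5)[OF g] a_minus_def C.r_neg
            clin_scal[OF L] del: scal_single)
    qed
    then show ?case
      by (simp add: clin_add[OF L] clin_scal[OF L] step kmod_smult_zero_right[OF C])
  qed
  define p' where "p' = (SOME q. q \<in> coset (tensor_kernel A B) p)"
  have "p \<in> coset (tensor_kernel A B) p"
    by (simp add: mem_coset_iff subspace_ofD(1)[OF subspace_tensor_kernel])
  then have "p' \<in> coset (tensor_kernel A B) p"
    unfolding p'_def by (rule someI)
  then have k: "p' - p \<in> tensor_kernel A B"
    by (simp add: mem_coset_iff)
  then have "p' - p \<in> carrier (free_tensor A B)"
    using tensor_kernel_carrier[OF A B] by blast
  with p have "p' - p + p \<in> {p. Poly_Mapping.keys p \<subseteq> carrier A \<times> carrier B}"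
    by (intro subspace_ofD(2)[OF subspace_keys]) simp_all
  then have keys: "Poly_Mapping.keys p' \<subseteq> carrier A \<times> carrier B" by simp
  have "sweedler C g (coset (tensor_kernel A B) p) = lin C (\<lambda>x. g (fst x) (snd x)) p'"
    by (simp add: sweedler_def lin_def p'_def[symmetric] Let_def)
  also have "\<dots> = lin C h p'"
    unfolding lin_def using keys
    by (intro C.finsum_cong') (auto simp: h_def kmod_smult_closed[OF C] bilinear_mapD(1)[OF g])
  also have "\<dots> = lin C h (p' - p) \<oplus>\<^bsub>C\<^esub> lin C h p"
    using clin_add[OF L, of "p' - p" p] by simp
  also have "\<dots> = lin C h p"
    by (simp add: ker[OF k] clin_closed[OF L])
  finally show ?thesis by (simp add: h_def[abs_def] case_prod_beta')
qed

text \<open>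
  The map \<open>F \<otimes> G\<close> from the tensor product of two spaces with bases to \<open>tensor A B\<close>. Elements
  of \<open>tensor A B\<close> are handled as values of such maps, so that calculations take place in the space
  with basis \<open>'x \<times> 'y\<close>.
\<close>

definition tensor_lin :: "('k::field, 'a) module \<Rightarrow> ('k, 'b) module \<Rightarrow> (('x \<Rightarrow>\<^sub>0 'k) \<Rightarrow> 'a) \<Rightarrow>
    (('y \<Rightarrow>\<^sub>0 'k) \<Rightarrow> 'b) \<Rightarrow> ('x \<times> 'y \<Rightarrow>\<^sub>0 'k) \<Rightarrow> ('a \<times> 'b \<Rightarrow>\<^sub>0 'k) set"
  where "tensor_lin A B F G p =
    coset (tensor_kernel A B) (ext (\<lambda>(x, y). basis (F (basis x), G (basis y))) p)"

lemma ext_tensor_carrier: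
  assumes "\<And>x. F x \<in> carrier A" "\<And>y. G y \<in> carrier B"
  shows "ext (\<lambda>(x, y). basis (F (basis x), G (basis y))) p \<in> carrier (free_tensor A B)"
proof (induction p rule: poly_mapping_linear_induct)
  case zero
  show ?case by (simp add: klin_zero[OF klin_ext])
next
  case (basis x)
  show ?case using assms by (cases x) simp
next
  case (add p q)
  then show ?case
    using subspace_ofD(2)[OF subspace_keys] by (simp add: klin_add[OF klin_ext])
next
  case (scal c p)
  then show ?case
    using subspace_ofD(3)[OF subspace_keys] by (simp add: klin_scal[OF klin_ext])
qed

lemma clin_tensor_lin:
  assumes "\<And>x. F x \<in> carrier A" "\<And>y. G y \<in> carrier B"
  shows "clin (tensor A B) (tensor_lin A B F G)"
proof (rule clinI)
  show "tensor_lin A B F G p \<in> carrier (tensor A B)" for p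
    unfolding tensor_lin_def tensor_carrier using ext_tensor_carrier[of F A G B p] assms by blast
qed (simp_all only: tensor_lin_def tensor_add tensor_smult klin_add[OF klin_ext] klin_scal[OF klin_ext])

lemma tensor_lin_basis: "tensor_lin A B F G (basis (x, y)) = pure_tensor A B (F (basis x)) (G (basis y))"
  by (simp add: tensor_lin_def pure_tensor_eq)

text \<open>
  Both sides are bilinear in \<open>p\<close> and \<open>q\<close>.
\<close>

lemma pure_tensor_lin:
  assumes "clin A F" "clin B G"
  shows "pure_tensor A B (F p) (G q) = tensor_lin A B F G (tens p q)"
proof (rule clin2_eqI[of "tensor A B" "\<lambda>p q. pure_tensor A B (F p) (G q)"
      "\<lambda>p q. tensor_lin A B F G (tens p q)", OF kmod_tensor])
  note bl = bilinear_pure_tensor[of A B]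
  have c: "F p \<in> carrier A" "G q \<in> carrier B" for p q
    using assms by (auto intro: clin_closed)
  note tl = clin_tensor_lin[of F A G B, OF c]
  show "clin (tensor A B) (\<lambda>p. pure_tensor A B (F p) (G q))" for q
    by (rule clinI) (simp_all add: bilinear_mapD[OF bl] c clin_add[OF assms(1)] clin_scal[OF assms(1)])
  show "clin (tensor A B) (\<lambda>q. pure_tensor A B (F p) (G q))" for p
    by (rule clinI) (simp_all add: bilinear_mapD[OF bl] c clin_add[OF assms(2)] clin_scal[OF assms(2)])
  show "clin (tensor A B) (\<lambda>p. tensor_lin A B F G (tens p q))" for q
    by (rule clin_comp[OF tl klin_tens_left])
  show "clin (tensor A B) (\<lambda>q. tensor_lin A B F G (tens p q))" for p
    by (rule clin_comp[OF tl klin_tens_right])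
  show "pure_tensor A B (F (basis x)) (G (basis y)) = tensor_lin A B F G (tens (basis x) (basis y))" for x y
    by (simp add: tensor_lin_basis)
qed

lemma
  assumes "kmod A" "kmod B" "kmod C" "bilinear_map A B C g"
    and c: "\<And>x. F x \<in> carrier A" "\<And>y. G y \<in> carrier B"
  shows clin_sweedler: "clin C (\<lambda>p. sweedler C g (tensor_lin A B F G p))"
    and sweedler_basis: "sweedler C g (tensor_lin A B F G (basis (x, y))) = g (F (basis x)) (G (basis y))"
proof -
  define h where "h = (\<lambda>(a, b). if a \<in> carrier A \<and> b \<in> carrier B then g a b else \<zero>\<^bsub>C\<^esub>)"
  have h: "h z \<in> carrier C" for z
    using bilinear_mapD(1)[OF assms(4)] abelian_monoid.zero_closed[OF abelian_group.axioms(1)[OF kmod_abelian_group[OF assms(3)]]]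
    by (simp add: h_def split: prod.split)
  have *: "sweedler C g (tensor_lin A B F G p) = lin C h (ext (\<lambda>(x, y). basis (F (basis x), G (basis y))) p)" for p
    unfolding tensor_lin_def h_def by (rule sweedler_coset[OF assms(1-4) ext_tensor_carrier[OF c]])
  show "clin C (\<lambda>p. sweedler C g (tensor_lin A B F G p))"
    unfolding * by (rule clin_comp[OF clin_lin[of C h, OF assms(3) h] klin_ext])
  show "sweedler C g (tensor_lin A B F G (basis (x, y))) = g (F (basis x)) (G (basis y))"
    unfolding * using lin_basis[of C h, OF assms(3) h] c by (simp add: h_def)
qed

text \<open>
  The tool for evaluating Sweedler expressions: guess the linear map \<open>H\<close> that the expression
  should be, and compare on basis elements, where it is a single pure tensor.
\<close>

lemma sweedler_tensor_lin:
  assumes "kmod A" "kmod B" "kmod C" "bilinear_map A B C g"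
    and "\<And>x. F x \<in> carrier A" "\<And>y. G y \<in> carrier B"
    and "clin C H" "\<And>x y. H (basis (x, y)) = g (F (basis x)) (G (basis y))"
  shows "sweedler C g (tensor_lin A B F G p) = H p"
proof (rule clin_eqI[OF assms(3) clin_sweedler[OF assms(1-6)] assms(7)])
  show "sweedler C g (tensor_lin A B F G (basis z)) = H (basis z)" for z
    by (cases z) (simp add: sweedler_basis[OF assms(1-6)] assms(8))
qed

section \<open>The product of a tensor product of algebras\<close>

lemma free_tensor_mult:
  "p \<otimes>\<^bsub>free_tensor A B\<^esub> q =
    ext (\<lambda>x. ext (\<lambda>y. basis (fst x \<otimes>\<^bsub>A\<^esub> fst y, snd x \<otimes>\<^bsub>B\<^esub> snd y)) q) p"
  by (simp add: free_tensor_def ext_def scal_sum)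

lemma klin_free_tensor_mult:
  "klin (\<lambda>p. p \<otimes>\<^bsub>free_tensor A B\<^esub> q)" "klin (\<lambda>q. p \<otimes>\<^bsub>free_tensor A B\<^esub> q)"
proof -
  show "klin (\<lambda>p. p \<otimes>\<^bsub>free_tensor A B\<^esub> q)"
    unfolding free_tensor_mult by (rule klin_ext)
  show "klin (\<lambda>q. p \<otimes>\<^bsub>free_tensor A B\<^esub> q)"
    unfolding free_tensor_mult
    by (rule klinI) (simp_all add: klin_add[OF klin_ext] klin_scal[OF klin_ext] ext_def[of _ p]
        scal_add_right sum.distrib scal_sum mult.commute)
qed

lemma free_tensor_mult_basis:
  "basis x \<otimes>\<^bsub>free_tensor A B\<^esub> basis y = basis (fst x \<otimes>\<^bsub>A\<^esub> fst y, snd x \<otimes>\<^bsub>B\<^esub> snd y)"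
  by (simp add: free_tensor_mult)

text \<open>
  A relation times a pure tensor is a relation of the same kind; the other side follows by
  commutativity.
\<close>

lemma tensor_kernel_absorb:
  assumes A: "algebra ring_of_type_algebra A" and B: "algebra ring_of_type_algebra B"
    and k: "k \<in> tensor_kernel A B" and q: "q \<in> carrier (free_tensor A B)"
  shows "k \<otimes>\<^bsub>free_tensor A B\<^esub> q \<in> tensor_kernel A B" "q \<otimes>\<^bsub>free_tensor A B\<^esub> k \<in> tensor_kernel A B"
proof -
  interpret A: algebra ring_of_type_algebra A by fact
  interpret B: algebra ring_of_type_algebra B by fact
  note sub = subspace_tensor_kernel[of A B]
  have smA: "(c \<odot>\<^bsub>A\<^esub> a) \<otimes>\<^bsub>A\<^esub> a' = c \<odot>\<^bsub>A\<^esub> (a \<otimes>\<^bsub>A\<^esub> a')" if "a \<in> carrier A" "a' \<in> carrier A" for c a a'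
    using A.smult_assoc2 that by simp
  have smB: "(c \<odot>\<^bsub>B\<^esub> a) \<otimes>\<^bsub>B\<^esub> a' = c \<odot>\<^bsub>B\<^esub> (a \<otimes>\<^bsub>B\<^esub> a')" if "a \<in> carrier B" "a' \<in> carrier B" for c a a'
    using B.smult_assoc2 that by simp
  have rel: "r \<otimes>\<^bsub>free_tensor A B\<^esub> basis (a0, b0) \<in> tensor_relations A B"
    if "r \<in> tensor_relations A B" "a0 \<in> carrier A" "b0 \<in> carrier B" for r a0 b0
    using that(1)
    by (cases rule: tensor_relations_cases; simp only:;
        simp add: klin_diff[OF klin_free_tensor_mult(1)] klin_scal[OF klin_free_tensor_mult(1)]
        free_tensor_mult_basis A.l_distr B.l_distr smA smB that(2,3) tensor_relationsI
        A.m_closed B.m_closed del: scal_single)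
  \<comment> \<open>The induction for linear maps runs through all of the type, so \<open>q\<close>, which is supported on the
    carriers, is expanded by hand.\<close>
  have expand: "q = (\<Sum>y\<in>Poly_Mapping.keys q. scal (Poly_Mapping.lookup q y) (basis y))"
    using ext_basis[of q] by (simp add: ext_def)
  have rel': "r \<otimes>\<^bsub>free_tensor A B\<^esub> q \<in> tensor_kernel A B" if r: "r \<in> tensor_relations A B" for r
  proof -
    have "(\<Sum>y\<in>S. scal (Poly_Mapping.lookup q y) (r \<otimes>\<^bsub>free_tensor A B\<^esub> basis y)) \<in> tensor_kernel A B"
      if "S \<subseteq> Poly_Mapping.keys q" for S
      using finite_subset[OF that finite_keys] that
    proof (induction S rule: finite_induct)
      case (insert y S)
      then have "fst y \<in> carrier A" "snd y \<in> carrier B" using q by auto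
      then have "r \<otimes>\<^bsub>free_tensor A B\<^esub> basis y \<in> tensor_kernel A B"
        using rel[OF r, of "fst y" "snd y"] by (simp add: tensor_relations_kernel)
      then show ?case
        using insert by (simp add: subspace_ofD[OF sub])
    qed (simp add: subspace_ofD[OF sub])
    then show ?thesis
      by (subst expand) (simp only: klin_sum[OF klin_free_tensor_mult(2)]
          klin_scal[OF klin_free_tensor_mult(2)] subset_refl)
  qed
  show *: "k \<otimes>\<^bsub>free_tensor A B\<^esub> q \<in> tensor_kernel A B"
    using k
  proof (induction k rule: tensor_kernel_induct)
    case zero
    show ?case
      by (simp only: klin_zero[OF klin_free_tensor_mult(1)] subspace_ofD(1)[OF sub])
  next
    case (step c r k)
    then show ?case
      by (simp only: klin_add[OF klin_free_tensor_mult(1)] klin_scal[OF klin_free_tensor_mult(1)]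
          subspace_ofD(2,3)[OF sub] rel')
  qed
  have kc: "k \<in> carrier (free_tensor A B)"
    using tensor_kernel_carrier[OF A.module B.module] k by blast
  have "q \<otimes>\<^bsub>free_tensor A B\<^esub> k = k \<otimes>\<^bsub>free_tensor A B\<^esub> q"
    unfolding free_tensor_def monoid.simps
    by (subst sum.swap) (use q kc in \<open>auto intro!: sum.cong simp: A.m_comm B.m_comm subset_iff mult.commute\<close>)
  with * show "q \<otimes>\<^bsub>free_tensor A B\<^esub> k \<in> tensor_kernel A B" by simp
qed

lemma tensor_lin_mult:
  fixes F :: "('x::comm_monoid_add \<Rightarrow>\<^sub>0 'k::field) \<Rightarrow> 'a" and G :: "('y::comm_monoid_add \<Rightarrow>\<^sub>0 'k) \<Rightarrow> 'b"
  assumes A: "algebra ring_of_type_algebra A" and B: "algebra ring_of_type_algebra B"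
    and c: "\<And>x. F x \<in> carrier A" "\<And>y. G y \<in> carrier B"
    and F: "\<And>x y. F (x * y) = F x \<otimes>\<^bsub>A\<^esub> F y" and G: "\<And>x y. G (x * y) = G x \<otimes>\<^bsub>B\<^esub> G y"
  shows "tensor_lin A B F G (p * q) = tensor_lin A B F G p \<otimes>\<^bsub>tensor A B\<^esub> tensor_lin A B F G q"
proof -
  let ?e = "ext (\<lambda>(x, y). basis (F (basis x), G (basis y)))"
  let ?R = "free_tensor A B" and ?K = "tensor_kernel A B"
  interpret A: algebra ring_of_type_algebra A by fact
  interpret B: algebra ring_of_type_algebra B by fact
  have e: "?e (p * q) = ?e p \<otimes>\<^bsub>?R\<^esub> ?e q"
  proof (rule klin2_eqI[of "\<lambda>p q. ?e (p * q)" "\<lambda>p q. ?e p \<otimes>\<^bsub>?R\<^esub> ?e q"])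
    show "?e (basis x * basis y) = ?e (basis x) \<otimes>\<^bsub>?R\<^esub> ?e (basis y)" for x y
      by (cases x; cases y) (simp add: free_tensor_mult_basis basis_add F G flip: basis_add[of "(_, _)"])
  qed (intro klin_comp[OF klin_ext] klin_intros klin_comp[OF klin_free_tensor_mult(1)]
      klin_comp[OF klin_free_tensor_mult(2)])+
  have "(j + ?e p) \<otimes>\<^bsub>?R\<^esub> (k + ?e q) - ?e p \<otimes>\<^bsub>?R\<^esub> ?e q \<in> ?K" if "j \<in> ?K" "k \<in> ?K" for j k
  proof -
    note abs = tensor_kernel_absorb[OF A B]
    have kc: "k \<in> carrier ?R"
      using tensor_kernel_carrier[OF A.module B.module] that by blast
    have "(j + ?e p) \<otimes>\<^bsub>?R\<^esub> (k + ?e q) - ?e p \<otimes>\<^bsub>?R\<^esub> ?e q =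
        j \<otimes>\<^bsub>?R\<^esub> k + j \<otimes>\<^bsub>?R\<^esub> ?e q + ?e p \<otimes>\<^bsub>?R\<^esub> k"
      by (simp only: klin_add[OF klin_free_tensor_mult(1)] klin_add[OF klin_free_tensor_mult(2)]) simp
    then show ?thesis
      using abs(1)[OF that(1) kc] abs(1)[OF that(1) ext_tensor_carrier[of F A G B q, OF c]]
        abs(2)[OF that(2) ext_tensor_carrier[of F A G B p, OF c]]
      by (simp only: subspace_ofD(2)[OF subspace_tensor_kernel])
  qed
  from quotient_mult[of ?R ?K "?e p" "?e q", OF free_tensor_simps(2) subspace_tensor_kernel this]
  show ?thesis
    by (simp only: tensor_lin_def tensor_def e)
qed

lemma tensor_one: "\<one>\<^bsub>tensor A B\<^esub> = pure_tensor A B \<one>\<^bsub>A\<^esub> \<one>\<^bsub>B\<^esub>"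
  unfolding tensor_def pure_tensor_eq
  by (subst quotient_one) (simp_all add: subspace_tensor_kernel)

section \<open>The symmetric algebra\<close>

lemma free_comm_algebra_simps [simp]:
  "carrier free_comm_algebra = UNIV" "add free_comm_algebra = (+)"
  "zero free_comm_algebra = 0" "one free_comm_algebra = 1"
  "monoid.mult free_comm_algebra = (*)" "module.smult free_comm_algebra = scal"
  by (simp_all add: free_comm_algebra_def type_algebra_def ring_of_type_algebra_def ring.defs
      module.defs scal_conv_mult fun_eq_iff)

lemma cring_free_comm_algebra: "cring (free_comm_algebra :: ('k::field, 'v multiset \<Rightarrow>\<^sub>0 'k) module)"
proof (rule cringI)
  show "abelian_group (free_comm_algebra :: ('k, 'v multiset \<Rightarrow>\<^sub>0 'k) module)"
    by (rule abelian_groupI) (auto simp: add_ac intro: exI[of _ "- _"])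
  show "comm_monoid (free_comm_algebra :: ('k, 'v multiset \<Rightarrow>\<^sub>0 'k) module)"
    by (rule comm_monoidI) (simp_all add: mult_ac)
qed (simp add: distrib_right)

definition sym_gens :: "('k::field \<Rightarrow> 'v::ab_group_add \<Rightarrow> 'v) \<Rightarrow> ('v multiset \<Rightarrow>\<^sub>0 'k) set"
  where "sym_gens scale = {gen (v + w) - gen v - gen w | v w. True} \<union>
    {gen (scale c v) - scal c (gen v) | c v. True}"

lemma sym_ideal_eq: "sym_ideal scale = genideal free_comm_algebra (sym_gens scale)"
  by (simp add: sym_ideal_def sym_gens_def)

lemma ideal_sym_ideal: "ideal (sym_ideal scale) free_comm_algebra"
  unfolding sym_ideal_eq
  by (rule ring.genideal_ideal[OF cring.axioms(1)[OF cring_free_comm_algebra]]) simp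

lemma sym_gens_ideal: "g \<in> sym_gens scale \<Longrightarrow> g \<in> sym_ideal scale"
  unfolding sym_ideal_eq
  using ring.genideal_self[OF cring.axioms(1)[OF cring_free_comm_algebra], of "sym_gens scale"]
  by auto

lemma sym_ideal_mult: "p \<in> sym_ideal scale \<Longrightarrow> q * p \<in> sym_ideal scale"
  using ideal.I_l_closed[OF ideal_sym_ideal, of p scale q] by simp

lemma subspace_sym_ideal: "subspace_of (sym_ideal scale)"
proof -
  note s = ideal.axioms(1)[OF ideal_sym_ideal[of scale]]
  show ?thesis
    unfolding subspace_of_def
  proof (intro conjI ballI allI)
    show "0 \<in> sym_ideal scale"
      using additive_subgroup.zero_closed[OF s] by simp
    show "p + q \<in> sym_ideal scale" if "p \<in> sym_ideal scale" "q \<in> sym_ideal scale" for p q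
      using additive_subgroup.a_closed[OF s that] by simp
    show "scal c p \<in> sym_ideal scale" if "p \<in> sym_ideal scale" for c p
      unfolding scal_conv_mult by (rule sym_ideal_mult[OF that])
  qed
qed

text \<open>
  The ideal generated by a subset of a commutative ring is its span over the ring.
\<close>

lemma sym_ideal_induct [consumes 1, case_names zero step]:
  fixes scale :: "'k::field \<Rightarrow> 'v::ab_group_add \<Rightarrow> 'v"
  assumes p: "p \<in> sym_ideal scale" and P: "P 0"
    "\<And>q g p. g \<in> sym_gens scale \<Longrightarrow> P p \<Longrightarrow> P (q * g + p)"
  shows "P p"
proof -
  let ?R = "free_comm_algebra :: ('k, 'v multiset \<Rightarrow>\<^sub>0 'k) module"
  interpret R: cring ?R by (rule cring_free_comm_algebra)
  interpret M: Modules.module "(*) :: ('v multiset \<Rightarrow>\<^sub>0 'k) \<Rightarrow> _"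
    by unfold_locales (simp_all add: algebra_simps)
  let ?J = "M.span (sym_gens scale)"
  have minus: "\<ominus>\<^bsub>?R\<^esub> q = - q" for q
    by (rule R.minus_equality) simp_all
  have "subgroup ?J (add_monoid ?R)"
    by (rule R.add.subgroupI) (auto simp: minus M.span_neg M.span_add a_inv_def[symmetric] intro: M.span_zero)
  moreover have "p * q \<in> ?J" if "p \<in> ?J" for p q
    using M.span_scale[OF that, of q] by (simp add: mult.commute)
  ultimately have "ideal ?J ?R"
    by (intro idealI[OF R.ring_axioms]) (simp_all add: M.span_scale)
  then have "sym_ideal scale \<subseteq> ?J"
    unfolding sym_ideal_eq by (rule R.genideal_minimal) (auto intro: M.span_base)
  with p have "p \<in> ?J" by blast
  then show ?thesis
    by (rule M.span_induct_alt) (fact P)+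
qed

definition cls :: "('k::field \<Rightarrow> 'v::ab_group_add \<Rightarrow> 'v) \<Rightarrow> ('v multiset \<Rightarrow>\<^sub>0 'k) \<Rightarrow> ('v multiset \<Rightarrow>\<^sub>0 'k) set"
  where "cls scale = coset (sym_ideal scale)"

lemma cls_eq_iff: "cls scale p = cls scale q \<longleftrightarrow> p - q \<in> sym_ideal scale"
  unfolding cls_def by (rule coset_eq_iff[OF subspace_sym_ideal])

lemma sym_alg_simps:
  shows sym_alg_carrier: "carrier (sym_alg scale) = range (cls scale)"
    and sym_alg_add: "cls scale p \<oplus>\<^bsub>sym_alg scale\<^esub> cls scale q = cls scale (p + q)"
    and sym_alg_zero: "\<zero>\<^bsub>sym_alg scale\<^esub> = cls scale 0"
    and sym_alg_one: "\<one>\<^bsub>sym_alg scale\<^esub> = cls scale 1"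
    and sym_alg_smult: "c \<odot>\<^bsub>sym_alg scale\<^esub> cls scale p = cls scale (scal c p)"
    and sym_incl_eq: "sym_incl scale v = cls scale (gen v)"
  unfolding sym_alg_def sym_incl_def cls_def
  by (simp_all only: quotient_carrier quotient_add quotient_zero quotient_one quotient_smult
      quotient_coset free_comm_algebra_simps subspace_sym_ideal)

lemma sym_alg_mult: "cls scale p \<otimes>\<^bsub>sym_alg scale\<^esub> cls scale q = cls scale (p * q)"
  unfolding sym_alg_def cls_def
proof (subst quotient_mult)
  fix j k assume "j \<in> sym_ideal scale" "k \<in> sym_ideal scale"
  then have "k * j + q * j + p * k \<in> sym_ideal scale"
    by (intro subspace_ofD(2)[OF subspace_sym_ideal] sym_ideal_mult)
  then show "(j + p) \<otimes>\<^bsub>free_comm_algebra\<^esub> (k + q) - p \<otimes>\<^bsub>free_comm_algebra\<^esub> q \<in> sym_ideal scale"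
    by (simp add: algebra_simps)
qed (simp_all add: subspace_sym_ideal)

lemma algebra_sym_alg: "algebra ring_of_type_algebra (sym_alg scale)"
proof (rule algebraI)
  show "cring (ring_of_type_algebra :: 'a ring)" ..
  show "cring (sym_alg scale)"
  proof (rule cringI)
    show "abelian_group (sym_alg scale)"
      unfolding sym_alg_def
      by (rule kmod_abelian_group[OF kmod_quotient])
         (simp_all add: subspace_sym_ideal, simp add: subspace_of_def)
    show "comm_monoid (sym_alg scale)"
      by (rule comm_monoidI) (auto simp: sym_alg_simps sym_alg_mult mult_ac)
  qed (auto simp: sym_alg_simps sym_alg_mult distrib_right)
qed (auto simp: sym_alg_simps sym_alg_mult scal_add_left scal_add_right scal_mult_left)

lemma kmod_sym_alg: "kmod (sym_alg scale)"
  by (rule algebra.axioms(1)[OF algebra_sym_alg])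

lemma cls_closed: "cls scale p \<in> carrier (sym_alg scale)"
  by (simp add: sym_alg_carrier)

lemma clin_cls: "clin (sym_alg scale) (cls scale)"
  by (rule clinI) (simp_all add: sym_alg_simps)

lemma sym_alg_finprod:
  "finite A \<Longrightarrow> (\<Otimes>\<^bsub>sym_alg scale\<^esub>i\<in>A. cls scale (g i)) = cls scale (\<Prod>i\<in>A. g i)"
proof -
  interpret algebra ring_of_type_algebra "sym_alg scale" by (rule algebra_sym_alg)
  show "finite A \<Longrightarrow> (\<Otimes>\<^bsub>sym_alg scale\<^esub>i\<in>A. cls scale (g i)) = cls scale (\<Prod>i\<in>A. g i)"
    by (induction A rule: finite_induct)
       (simp_all add: sym_alg_one[symmetric] sym_alg_mult cls_closed Pi_def)
qed

lemmas sym_alg_finsum = clin_sum[OF kmod_sym_alg clin_cls, symmetric]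

lemma bilinear_map_clsI:
  assumes "\<And>p q. g (cls scale p) (cls scale q) = H p q"
    and "\<And>q. clin C (\<lambda>p. H p q)" "\<And>p. clin C (H p)"
  shows "bilinear_map (sym_alg scale) (sym_alg scale) C g"
  unfolding bilinear_map_def
  by (auto simp: sym_alg_simps assms(1) clin_add[OF assms(2)] clin_add[OF assms(3)]
      clin_scal[OF assms(2)] clin_scal[OF assms(3)] clin_closed[OF assms(3)])

subsection \<open>The coproduct\<close>

abbreviation sym_tensor :: "('k::field \<Rightarrow> 'v::ab_group_add \<Rightarrow> 'v) \<Rightarrow> _"
  where "sym_tensor scale \<equiv> tensor (sym_alg scale) (sym_alg scale)"

text \<open>
  The map \<open>cls \<otimes> cls\<close> from the tensor square of the polynomial algebra onto that of the
  symmetric algebra.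
\<close>

definition tcls :: "('k::field \<Rightarrow> 'v::ab_group_add \<Rightarrow> 'v) \<Rightarrow> ('v multiset \<times> 'v multiset \<Rightarrow>\<^sub>0 'k) \<Rightarrow> _"
  where "tcls scale = tensor_lin (sym_alg scale) (sym_alg scale) (cls scale) (cls scale)"

lemma clin_tcls: "clin (sym_tensor scale) (tcls scale)"
  unfolding tcls_def by (rule clin_tensor_lin[OF cls_closed cls_closed])

lemma tcls_mult: "tcls scale (p * q) = tcls scale p \<otimes>\<^bsub>sym_tensor scale\<^esub> tcls scale q"
  unfolding tcls_def
  by (rule tensor_lin_mult[OF algebra_sym_alg algebra_sym_alg cls_closed cls_closed])
     (simp_all add: sym_alg_mult)

lemma pure_cls: "pure_tensor (sym_alg scale) (sym_alg scale) (cls scale p) (cls scale q) =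
    tcls scale (tens p q)"
  unfolding tcls_def by (rule pure_tensor_lin[OF clin_cls clin_cls])

lemma tcls_one: "\<one>\<^bsub>sym_tensor scale\<^esub> = tcls scale 1"
  by (simp add: tensor_one sym_alg_one pure_cls tens_one)

lemma sweedler_tcls:
  assumes "kmod C" "bilinear_map (sym_alg scale) (sym_alg scale) C g" "clin C H"
    "\<And>m n. g (cls scale (basis m)) (cls scale (basis n)) = H (basis (m, n))"
  shows "sweedler C g (tcls scale p) = H p"
  unfolding tcls_def
  by (rule sweedler_tensor_lin[OF kmod_sym_alg kmod_sym_alg assms(1,2) cls_closed cls_closed assms(3)])
     (simp add: assms(4))

text \<open>
  The generators of the ideal are combinations of indeterminates, and the primitive elements
  form a subspace.
\<close>

lemma coprod_sym_gens: "g \<in> sym_gens scale \<Longrightarrow> coprod g = tens g 1 + tens 1 g"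
  unfolding sym_gens_def
  by (elim UnE CollectE exE conjE; hypsubst)
     (simp_all only: coprod_gen coprod_simps tens_simps scal_add_right, simp_all add: algebra_simps)

text \<open>
  The kernel of \<open>cls \<otimes> cls\<close> contains the ideal generated by \<open>I \<otimes> 1\<close> and \<open>1 \<otimes> I\<close>, where
  \<open>I\<close> is \<open>sym_ideal scale\<close>.
\<close>

lemma tcls_mult_tens_zero:
  assumes "p \<in> sym_ideal scale \<or> q \<in> sym_ideal scale"
  shows "tcls scale (x * tens p q) = tcls scale 0"
proof -
  have "tcls scale (x * tens p q) = tcls scale (x * 0)"
  proof (rule clin_eqI[OF kmod_tensor, of _ _ "\<lambda>x. tcls scale (x * tens p q)" "\<lambda>x. tcls scale (x * 0)"])
    show "clin (sym_tensor scale) (\<lambda>x. tcls scale (x * tens p q))"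
      and "clin (sym_tensor scale) (\<lambda>x. tcls scale (x * 0))"
      by (rule clin_comp[OF clin_tcls klin_mult_left[OF klin_id]])+
    show "tcls scale (basis z * tens p q) = tcls scale (basis z * 0)" for z
    proof -
      obtain m n where z: "z = (m, n)" by (cases z)
      have "tcls scale (basis z * tens p q) = tcls scale (tens (basis m * p) (basis n * q))"
        unfolding z tens_basis[symmetric] tens_mult ..
      also have "\<dots> = tcls scale 0"
      proof (cases "p \<in> sym_ideal scale")
        case True
        then have "cls scale (basis m * p) = cls scale 0"
          by (simp add: cls_eq_iff sym_ideal_mult)
        then show ?thesis
          unfolding pure_cls[symmetric] by (simp add: pure_cls tens_simps)
      next
        case False
        then have "cls scale (basis n * q) = cls scale 0"
          using assms by (simp add: cls_eq_iff sym_ideal_mult)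
        then show ?thesis
          unfolding pure_cls[symmetric] by (simp add: pure_cls tens_simps)
      qed
      finally show ?thesis by simp
    qed
  qed
  then show ?thesis by simp
qed

text \<open>
  A generator is primitive, so the coproduct of each of its multiples is killed by
  \<open>tcls_mult_tens_zero\<close>.
\<close>

lemma tcls_coprod_ideal:
  assumes "p \<in> sym_ideal scale"
  shows "tcls scale (coprod p) = tcls scale 0"
  using assms
proof (induction p rule: sym_ideal_induct)
  case zero
  show ?case by (simp add: klin_zero[OF khom_klin[OF khom_coprod]])
next
  case (step q g p)
  note c = clin_add[OF clin_tcls, of scale]
  have "g \<in> sym_ideal scale" using step(1) by (rule sym_gens_ideal)
  then show ?case
    by (simp add: coprod_simps coprod_sym_gens[OF step(1)] distrib_left c step
        tcls_mult_tens_zero c[symmetric])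
qed

lemma tcls_coprod_cong: "cls scale p = cls scale q \<Longrightarrow> tcls scale (coprod p) = tcls scale (coprod q)"
proof -
  assume "cls scale p = cls scale q"
  then have "tcls scale (coprod (p - q)) = tcls scale 0"
    by (intro tcls_coprod_ideal) (simp add: cls_eq_iff)
  then have "tcls scale (coprod (p - q) + coprod q) = tcls scale (0 + coprod q)"
    by (simp only: clin_add[OF clin_tcls])
  then show ?thesis by (simp add: coprod_simps)
qed

text \<open>
  An algebra map on the symmetric algebra is determined by its values on vectors, and
  \<open>coprod\<close> has the prescribed ones.
\<close>

lemma sym_coproduct_iff:
  "sym_coproduct scale D \<longleftrightarrow> (\<forall>p. D (cls scale p) = tcls scale (coprod p))"
proof
  assume "sym_coproduct scale D"
  then have hom: "D \<in> ring_hom (sym_alg scale) (sym_tensor scale)"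
    and sm: "\<And>c x. x \<in> carrier (sym_alg scale) \<Longrightarrow> D (c \<odot>\<^bsub>sym_alg scale\<^esub> x) = c \<odot>\<^bsub>sym_tensor scale\<^esub> D x"
    and X: "\<And>v. D (cls scale (gen v)) = tcls scale (coprod (gen v))"
    by (auto simp: sym_coproduct_def alg_hom_def Let_def sym_incl_eq sym_alg_one pure_cls
        coprod_gen clin_add[OF clin_tcls])
  note h = ring_hom_closed[OF hom cls_closed] ring_hom_mult[OF hom cls_closed cls_closed]
    ring_hom_add[OF hom cls_closed cls_closed] ring_hom_one[OF hom] sm[OF cls_closed]
  have lD: "clin (sym_tensor scale) (\<lambda>p. D (cls scale p))"
    using h by (intro clinI) (simp_all add: sym_alg_simps)
  have lc: "clin (sym_tensor scale) (\<lambda>p. tcls scale (coprod p))"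
    by (rule clin_comp[OF clin_tcls khom_klin[OF khom_coprod]])
  have "D (cls scale (basis m)) = tcls scale (coprod (basis m))" for m
  proof (rule basis_multiset_induct[of "\<lambda>p. D (cls scale p) = tcls scale (coprod p)"])
    show "D (cls scale 1) = tcls scale (coprod 1)"
      using h(4) by (simp add: sym_alg_one coprod_simps tcls_one)
    fix v m assume "D (cls scale (basis m)) = tcls scale (coprod (basis m))"
    then show "D (cls scale (gen v * basis m)) = tcls scale (coprod (gen v * basis m))"
      using h(2)[of "gen v" "basis m"] by (simp only: sym_alg_mult X coprod_simps tcls_mult)
  qed
  from clin_eqI[OF kmod_tensor lD lc this]
  show "\<forall>p. D (cls scale p) = tcls scale (coprod p)" by blast
next
  assume D: "\<forall>p. D (cls scale p) = tcls scale (coprod p)"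
  have "D \<in> ring_hom (sym_alg scale) (sym_tensor scale)"
    by (rule ring_hom_memI)
       (auto simp: sym_alg_simps sym_alg_mult D coprod_simps tcls_mult tcls_one
         clin_add[OF clin_tcls] clin_closed[OF clin_tcls])
  then show "sym_coproduct scale D"
    by (auto simp: sym_coproduct_def alg_hom_def Let_def sym_incl_eq sym_alg_simps pure_cls D
        coprod_gen coprod_simps clin_add[OF clin_tcls] clin_scal[OF clin_tcls])
qed

lemma ex_sym_coproduct: "\<exists>D. sym_coproduct scale D"
proof -
  define D where "D x = tcls scale (coprod (SOME p. cls scale p = x))" for x
  have "D (cls scale p) = tcls scale (coprod p)" for p
    unfolding D_def by (rule tcls_coprod_cong, rule someI[of _ p]) (rule refl)
  then show ?thesis using sym_coproduct_iff by blast
qed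

subsection \<open>The product\<close>

text \<open>
  Linearity of \<open>f\<close> says that the derivation kills the generators of the ideal; the Leibniz
  rule extends this to stability of the ideal.
\<close>

lemma deriv_sym_ideal:
  fixes f :: "'v::ab_group_add \<Rightarrow> 'k::field"
  assumes f: "Vector_Spaces.linear scale (*) f" and p: "p \<in> sym_ideal scale"
  shows "deriv f p \<in> sym_ideal scale"
  using p
proof (induction p rule: sym_ideal_induct)
  case zero
  show ?case by (simp add: klin_zero[OF klin_deriv] subspace_ofD[OF subspace_sym_ideal])
next
  case (step q g p)
  interpret f: Vector_Spaces.linear scale "(*)" f by (rule f)
  have "deriv f g = 0"
    using step(1)
    by (auto simp: sym_gens_def klin_diff[OF klin_deriv] klin_scal[OF klin_deriv] f.add f.scale
        scal_add_left simp del: scal_single)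
  then show ?case
    using step(2) sym_ideal_mult[OF sym_gens_ideal[OF step(1)]]
    by (simp add: klin_add[OF klin_deriv] deriv_mult subspace_ofD[OF subspace_sym_ideal])
qed

lemma eps_sym_ideal: "p \<in> sym_ideal scale \<Longrightarrow> eps p = 0"
proof (induction p rule: sym_ideal_induct)
  case (step q g p)
  have "eps g = 0"
    using step(1) by (auto simp: sym_gens_def eps_basis simp del: scal_single)
  then show ?case using step by simp
qed simp

text \<open>
  Stability under the derivation passes to its geometric series by \<open>deriv_induct\<close>, and the
  constant term of an element of the ideal is \<open>0\<close>.
\<close>

lemma trunc_resolvent_sym_ideal:
  fixes f :: "'v::ab_group_add \<Rightarrow> 'k::field"
  assumes f: "Vector_Spaces.linear scale (*) f" and p: "p \<in> sym_ideal scale"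
  shows "trunc_resolvent l f p \<in> sym_ideal scale"
proof -
  note sub = subspace_ofD[OF subspace_sym_ideal[of scale]]
  have "p \<in> sym_ideal scale \<longrightarrow> resolvent l f p \<in> sym_ideal scale"
  proof (rule deriv_induct[of "\<lambda>p. p \<in> sym_ideal scale \<longrightarrow> resolvent l f p \<in> sym_ideal scale" f])
    show "0 \<in> sym_ideal scale \<longrightarrow> resolvent l f 0 \<in> sym_ideal scale"
      by (simp add: klin_zero[OF klin_resolvent])
    fix p assume "deriv f p \<in> sym_ideal scale \<longrightarrow> resolvent l f (deriv f p) \<in> sym_ideal scale"
    then show "p \<in> sym_ideal scale \<longrightarrow> resolvent l f p \<in> sym_ideal scale"
      using deriv_sym_ideal[OF f, of p] sub(2)[of p "scal l (resolvent l f (deriv f p))"] sub(3)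
      by (subst resolvent_deriv) simp
  qed
  then show ?thesis
    using p by (simp add: trunc_resolvent_def eps_sym_ideal)
qed

lemma bullet_cong:
  fixes f :: "'v::ab_group_add \<Rightarrow> 'k::field"
  assumes f: "Vector_Spaces.linear scale (*) f"
    and "cls scale p = cls scale p'" "cls scale q = cls scale q'"
  shows "cls scale (bullet l f p q) = cls scale (bullet l f p' q')"
proof -
  have p: "deriv f (p - p') \<in> sym_ideal scale"
    using deriv_sym_ideal[OF f] assms(2) by (simp add: cls_eq_iff)
  have q: "trunc_resolvent l f (q - q') \<in> sym_ideal scale"
    using trunc_resolvent_sym_ideal[OF f] assms(3) by (simp add: cls_eq_iff)
  have "bullet l f p q - bullet l f p' q' =
      trunc_resolvent l f q * deriv f (p - p') + deriv f p' * trunc_resolvent l f (q - q')"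
    by (simp add: bullet_def klin_diff[OF klin_deriv] klin_diff[OF klin_trunc_resolvent] algebra_simps)
  then show ?thesis
    unfolding cls_eq_iff
    using p q by (simp add: sym_ideal_mult subspace_ofD[OF subspace_sym_ideal])
qed

lemma basis_multiset_eq_prod:
  fixes m :: "'v multiset"
  obtains k :: nat and x :: "nat \<Rightarrow> 'v" where "(basis m :: 'v multiset \<Rightarrow>\<^sub>0 'k::field) = (\<Prod>i\<in>{1..k}. gen (x i))"
proof -
  have "\<exists>(k::nat) x. (basis m :: 'v multiset \<Rightarrow>\<^sub>0 'k) = (\<Prod>i\<in>{1..k}. gen (x i))"
  proof (induction m)
    case empty
    show ?case by (intro exI[of _ 0]) simp
  next
    case (add v m)
    then obtain k :: nat and x where m: "(basis m :: 'v multiset \<Rightarrow>\<^sub>0 'k) = (\<Prod>i\<in>{1..k}. gen (x i))" by blast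
    have "(\<Prod>i\<in>{1..Suc k}. gen ((x(Suc k := v)) i) :: 'v multiset \<Rightarrow>\<^sub>0 'k) =
        (\<Prod>i\<in>{1..k}. gen ((x(Suc k := v)) i)) * gen v"
      by (simp add: atLeastAtMostSuc_conv mult.commute)
    also have "(\<Prod>i\<in>{1..k}. gen ((x(Suc k := v)) i) :: 'v multiset \<Rightarrow>\<^sub>0 'k) = basis m"
      unfolding m by (intro prod.cong) auto
    finally have "(basis (add_mset v m) :: 'v multiset \<Rightarrow>\<^sub>0 'k) =
        (\<Prod>i\<in>{1..Suc k}. gen ((x(Suc k := v)) i))"
      by (subst basis_add_mset) (simp add: mult.commute)
    then show ?case by blast
  qed
  then show ?thesis using that by blast
qed

text \<open>
  The clause for \<open>x \<bullet> x\<^sub>1 \<cdots> x\<^sub>k\<close> fixes the product of a vector and a monomial, then the clause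
  for \<open>x\<^sub>1 \<cdots> x\<^sub>k \<bullet> x\<close> that of two monomials, and bilinearity all others. Conversely the closed
  form satisfies all clauses.
\<close>

lemma sym_bullet_iff:
  fixes f :: "'v::ab_group_add \<Rightarrow> 'k::field"
  shows "sym_bullet scale f l b \<longleftrightarrow>
    (\<forall>p q. b (cls scale p) (cls scale q) = cls scale (bullet l f p q))"
    (is "?L \<longleftrightarrow> ?R")
proof -
  let ?S = "sym_alg scale"
  have bil: "bilinear_map ?S ?S ?S b" if ?R
    using that
    by (intro bilinear_map_clsI[of b scale "\<lambda>p q. cls scale (bullet l f p q)"])
       (auto intro: clin_comp[OF clin_cls klin_bullet_left] clin_comp[OF clin_cls klin_bullet_right])
  have gen_prod: "(\<Oplus>\<^bsub>?S\<^esub>I\<in>{I. I \<subset> {1..k}}.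
       (of_nat (fact (card I)) * l ^ card I * f v * (\<Prod>i\<in>I. f (x i)))
         \<odot>\<^bsub>?S\<^esub> (\<Otimes>\<^bsub>?S\<^esub>i\<in>{1..k} - I. sym_incl scale (x i))) =
     cls scale (bullet l f (gen v) (\<Prod>i\<in>{1..k}. gen (x i)))" for v x and k :: nat
  proof -
    have "finite {I. I \<subset> {1..k}}"
      by (rule finite_subset[of _ "Pow {1..k}"]) auto
    then show ?thesis
      by (simp add: sym_incl_eq sym_alg_finprod sym_alg_smult sym_alg_finsum bullet_gen_prod)
  qed
  have prod_gen: "(\<Oplus>\<^bsub>?S\<^esub>i\<in>{1..k}. \<Otimes>\<^bsub>?S\<^esub>j\<in>{1..k}. if j = i then b (sym_incl scale (x j)) (cls scale p) else sym_incl scale (x j)) =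
     cls scale (bullet l f (\<Prod>i\<in>{1..k}. gen (x i)) p)"
    if "\<And>v. b (cls scale (gen v)) (cls scale p) = cls scale (bullet l f (gen v) p)" for x p and k :: nat
  proof -
    have "(if j = i then b (sym_incl scale (x j)) (cls scale p) else sym_incl scale (x j)) =
        cls scale (if j = i then bullet l f (gen (x j)) p else gen (x j))" for i j
      by (simp add: sym_incl_eq that)
    then show ?thesis
      by (simp only: sym_alg_finprod sym_alg_finsum finite_atLeastAtMost bullet_prod_gen)
  qed
  show ?thesis
  proof
    assume L: ?L
    then have bl: "bilinear_map ?S ?S ?S b"
      by (simp add: sym_bullet_def Let_def)
    have 1: "b (cls scale (gen v)) (cls scale (\<Prod>i\<in>{1..k}. gen (x i))) =
        cls scale (bullet l f (gen v) (\<Prod>i\<in>{1..k}. gen (x i)))" for v x and k :: nat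
    proof -
      have "b (sym_incl scale v) (\<Otimes>\<^bsub>?S\<^esub>i\<in>{1..k}. sym_incl scale (x i)) =
          cls scale (bullet l f (gen v) (\<Prod>i\<in>{1..k}. gen (x i)))"
        unfolding gen_prod[symmetric] using L unfolding sym_bullet_def Let_def by blast
      then show ?thesis by (simp add: sym_incl_eq sym_alg_finprod)
    qed
    have 2: "b (cls scale (gen v)) (cls scale (basis n)) = cls scale (bullet l f (gen v) (basis n))" for v n
    proof -
      obtain k :: nat and x where n: "(basis n :: 'v multiset \<Rightarrow>\<^sub>0 'k) = (\<Prod>i\<in>{1..k}. gen (x i))"
        by (rule basis_multiset_eq_prod)
      show ?thesis unfolding n by (rule 1)
    qed
    have 3: "b (cls scale (\<Prod>i\<in>{1..k}. gen (x i))) (cls scale (basis n)) =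
        cls scale (bullet l f (\<Prod>i\<in>{1..k}. gen (x i)) (basis n))" for n x and k :: nat
    proof -
      have "b (\<Otimes>\<^bsub>?S\<^esub>i\<in>{1..k}. sym_incl scale (x i)) (cls scale (basis n)) =
          cls scale (bullet l f (\<Prod>i\<in>{1..k}. gen (x i)) (basis n))"
        unfolding prod_gen[OF 2, symmetric] using L cls_closed unfolding sym_bullet_def Let_def by blast
      then show ?thesis by (simp add: sym_incl_eq sym_alg_finprod)
    qed
    have 4: "b (cls scale (basis m)) (cls scale (basis n)) = cls scale (bullet l f (basis m) (basis n))" for m n
    proof -
      obtain k :: nat and x where m: "(basis m :: 'v multiset \<Rightarrow>\<^sub>0 'k) = (\<Prod>i\<in>{1..k}. gen (x i))"
        by (rule basis_multiset_eq_prod)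
      show ?thesis unfolding m by (rule 3)
    qed
    note bD = bilinear_mapD[OF bl]
    have "b (cls scale p) (cls scale q) = cls scale (bullet l f p q)" for p q
    proof (rule clin2_eqI[OF kmod_sym_alg, of scale "\<lambda>p q. b (cls scale p) (cls scale q)" "\<lambda>p q. cls scale (bullet l f p q)"])
      show "clin ?S (\<lambda>p. b (cls scale p) (cls scale q))" for q
        by (rule clinI) (simp_all add: bD cls_closed flip: sym_alg_add sym_alg_smult)
      show "clin ?S (\<lambda>q. b (cls scale p) (cls scale q))" for p
        by (rule clinI) (simp_all add: bD cls_closed flip: sym_alg_add sym_alg_smult)
    qed (rule clin_comp[OF clin_cls klin_bullet_left] clin_comp[OF clin_cls klin_bullet_right] 4)+
    then show ?R by blast
  next
    assume R: ?R
    have 1: "b (sym_incl scale v) (\<Otimes>\<^bsub>?S\<^esub>i\<in>{1..k}. sym_incl scale (x i)) =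
        cls scale (bullet l f (gen v) (\<Prod>i\<in>{1..k}. gen (x i)))" for v x and k :: nat
      by (simp add: sym_incl_eq sym_alg_finprod R)
    have 2: "b (\<Otimes>\<^bsub>?S\<^esub>i\<in>{1..k}. sym_incl scale (x i)) (cls scale p) =
        cls scale (bullet l f (\<Prod>i\<in>{1..k}. gen (x i)) p)" for x p and k :: nat
      by (simp add: sym_incl_eq sym_alg_finprod R)
    have 3: "b \<one>\<^bsub>?S\<^esub> (cls scale p) = \<zero>\<^bsub>?S\<^esub>" for p
      by (simp add: sym_alg_simps R bullet_one)
    have all: "(\<forall>x\<in>carrier ?S. Q x) \<longleftrightarrow> (\<forall>p. Q (cls scale p))" for Q
      by (auto simp: sym_alg_carrier)
    show ?L
      unfolding sym_bullet_def Let_def all gen_prod 1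
      using bil[OF R] 2 3 prod_gen R by simp
  qed
qed

lemma ex_sym_bullet:
  fixes f :: "'v::ab_group_add \<Rightarrow> 'k::field"
  assumes f: "Vector_Spaces.linear scale (*) f"
  shows "\<exists>b. sym_bullet scale f l b"
proof -
  define r where "r x = (SOME p. cls scale p = x)" for x
  have r: "cls scale (r (cls scale p)) = cls scale p" for p
    unfolding r_def by (rule someI[of _ p]) (rule refl)
  have "cls scale (bullet l f (r (cls scale p)) (r (cls scale q))) = cls scale (bullet l f p q)" for p q
    by (rule bullet_cong[OF f r r])
  then have "sym_bullet scale f l (\<lambda>x y. cls scale (bullet l f (r x) (r y)))"
    by (simp add: sym_bullet_iff)
  then show ?thesis by blast
qed

section \<open>The Com-PreLie bialgebra\<close>

lemma com_prelie_algebra_sym_alg: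
  assumes "sym_bullet scale f l b"
  shows "com_prelie_algebra (sym_alg scale) b"
proof -
  have b: "b (cls scale p) (cls scale q) = cls scale (bullet l f p q)" for p q
    using assms by (simp add: sym_bullet_iff)
  have minus: "cls scale p \<ominus>\<^bsub>sym_alg scale\<^esub> cls scale q = cls scale (p - q)" for p q
    by (rule clin_diff[OF kmod_sym_alg clin_cls, symmetric])
  show ?thesis
    unfolding com_prelie_algebra_def
  proof (intro conjI ballI)
    show "bilinear_map (sym_alg scale) (sym_alg scale) (sym_alg scale) b"
      using assms by (simp add: sym_bullet_def Let_def)
  next
    fix x y z assume "x \<in> carrier (sym_alg scale)" "y \<in> carrier (sym_alg scale)" "z \<in> carrier (sym_alg scale)"
    then obtain p q r where xyz: "x = cls scale p" "y = cls scale q" "z = cls scale r"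
      by (auto simp: sym_alg_carrier)
    show "b (b x y) z \<ominus>\<^bsub>sym_alg scale\<^esub> b x (b y z) = b (b x z) y \<ominus>\<^bsub>sym_alg scale\<^esub> b x (b z y)"
      unfolding xyz b minus by (simp only: bullet_prelie[of l f p q r])
    show "b (x \<otimes>\<^bsub>sym_alg scale\<^esub> y) z =
        b x z \<otimes>\<^bsub>sym_alg scale\<^esub> y \<oplus>\<^bsub>sym_alg scale\<^esub> x \<otimes>\<^bsub>sym_alg scale\<^esub> b y z"
      unfolding xyz b sym_alg_mult sym_alg_add by (simp only: bullet_leibniz)
  qed (rule algebra_sym_alg)
qed

text \<open>
  Each iterated Sweedler sum is identified with the image of the corresponding expression on
  polynomials, whence coassociativity and the counit laws follow from \<open>coprod_coassoc\<close> and
  \<open>coprod_counit\<close>.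
\<close>

lemma bialgebra_sym_alg:
  fixes scale :: "'k::field \<Rightarrow> 'v::ab_group_add \<Rightarrow> 'v"
  assumes "sym_coproduct scale D"
  shows "bialgebra (sym_alg scale) D"
proof -
  let ?S = "sym_alg scale"
  let ?T = "sym_tensor scale"
  let ?T3 = "tensor ?S ?T"
  have D: "D (cls scale p) = tcls scale (coprod p)" for p
    using assms by (simp add: sym_coproduct_iff)
  define tcls3 where "tcls3 = tensor_lin ?S ?T (cls scale) (tcls scale)"
  have clin3: "clin ?T3 tcls3"
    unfolding tcls3_def by (rule clin_tensor_lin[OF cls_closed clin_closed[OF clin_tcls]])
  have pure3: "pure_tensor ?S ?T (cls scale p) (tcls scale q) = tcls3 (tens p q)" for p q
    unfolding tcls3_def by (rule pure_tensor_lin[OF clin_cls clin_tcls])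
  note kl = klin_comp[OF khom_klin[OF khom_tassoc]]
  have inner: "sweedler ?T3 (\<lambda>u v. pure_tensor ?S ?T u (pure_tensor ?S ?S v (cls scale q))) (D (cls scale p)) =
      tcls3 (tassoc (tens (coprod p) q))" for p q
    unfolding D
  proof (rule sweedler_tcls[OF kmod_tensor])
    show "clin ?T3 (\<lambda>a. tcls3 (tassoc (tens a q)))"
      by (rule clin_comp[OF clin3 kl[OF klin_tens_left]])
    show "bilinear_map ?S ?S ?T3 (\<lambda>u v. pure_tensor ?S ?T u (pure_tensor ?S ?S v (cls scale q)))"
      by (rule bilinear_map_clsI[where H = "\<lambda>p p'. tcls3 (tens p (tens p' q))"])
         (simp add: pure_cls pure3,
          rule clin_comp[OF clin3 klin_tens_left],
          rule clin_comp[OF clin3 klin_comp[OF klin_tens_right klin_tens_left]])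
    show "pure_tensor ?S ?T (cls scale (basis m)) (pure_tensor ?S ?S (cls scale (basis n)) (cls scale q)) =
        tcls3 (tassoc (tens (basis (m, n)) q))" for m n
      unfolding pure_cls pure3 tens_basis[symmetric] tassoc_tens ..
  qed
  have left: "sweedler ?T3 (\<lambda>y z. sweedler ?T3 (\<lambda>u v. pure_tensor ?S ?T u (pure_tensor ?S ?S v z)) (D y))
      (tcls scale a) = tcls3 (tassoc (tmap coprod (\<lambda>p. p) a))" for a
  proof (rule sweedler_tcls[OF kmod_tensor])
    show "clin ?T3 (\<lambda>a. tcls3 (tassoc (tmap coprod (\<lambda>p. p) a)))"
      by (rule clin_comp[OF clin3 kl[OF klin_tmap]])
    show "bilinear_map ?S ?S ?T3 (\<lambda>y z. sweedler ?T3 (\<lambda>u v. pure_tensor ?S ?T u (pure_tensor ?S ?S v z)) (D y))"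
      by (rule bilinear_map_clsI[where H = "\<lambda>p q. tcls3 (tassoc (tens (coprod p) q))"])
         (rule inner,
          rule clin_comp[OF clin3 kl[OF klin_comp[OF klin_tens_left khom_klin[OF khom_coprod]]]],
          rule clin_comp[OF clin3 kl[OF klin_tens_right]])
    show "sweedler ?T3 (\<lambda>u v. pure_tensor ?S ?T u (pure_tensor ?S ?S v (cls scale (basis n)))) (D (cls scale (basis m))) =
        tcls3 (tassoc (tmap coprod (\<lambda>p. p) (basis (m, n))))" for m n
      unfolding inner tmap_basis ..
  qed
  have right: "sweedler ?T3 (\<lambda>y z. pure_tensor ?S ?T y (D z)) (tcls scale a) =
      tcls3 (tmap (\<lambda>p. p) coprod a)" for a
  proof (rule sweedler_tcls[OF kmod_tensor])
    show "clin ?T3 (\<lambda>a. tcls3 (tmap (\<lambda>p. p) coprod a))"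
      by (rule clin_comp[OF clin3 klin_tmap])
    show "bilinear_map ?S ?S ?T3 (\<lambda>y z. pure_tensor ?S ?T y (D z))"
      by (rule bilinear_map_clsI[where H = "\<lambda>p q. tcls3 (tens p (coprod q))"])
         (simp add: D pure3,
          rule clin_comp[OF clin3 klin_tens_left],
          rule clin_comp[OF clin3 klin_comp[OF klin_tens_right khom_klin[OF khom_coprod]]])
    show "pure_tensor ?S ?T (cls scale (basis m)) (D (cls scale (basis n))) =
        tcls3 (tmap (\<lambda>p. p) coprod (basis (m, n)))" for m n
      unfolding D pure3 tmap_basis ..
  qed
  define E where "E x = eps (SOME p. cls scale p = x)" for x
  have E: "E (cls scale p) = eps p" for p
  proof -
    have "cls scale (SOME q. cls scale q = cls scale p) = cls scale p"
      by (rule someI[of _ p]) (rule refl)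
    then show ?thesis
      unfolding E_def cls_eq_iff by (auto dest: eps_sym_ideal)
  qed
  have "E \<in> ring_hom ?S (type_algebra (*))"
    by (rule ring_hom_memI)
       (auto simp: type_algebra_def ring_of_type_algebra_def ring.defs sym_alg_simps sym_alg_mult E)
  then have "E \<in> alg_hom ?S (type_algebra (*))"
    by (auto simp: alg_hom_def type_algebra_def module.defs ring.defs sym_alg_simps E)
  moreover have "sweedler ?S (\<lambda>y z. E y \<odot>\<^bsub>?S\<^esub> z) (tcls scale a) = cls scale (counit_left a)" for a
  proof (rule sweedler_tcls[OF kmod_sym_alg])
    show "clin ?S (\<lambda>a. cls scale (counit_left a))"
      by (rule clin_comp[OF clin_cls klin_counit(1)])
    show "bilinear_map ?S ?S ?S (\<lambda>y z. E y \<odot>\<^bsub>?S\<^esub> z)"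
      by (rule bilinear_map_clsI[where H = "\<lambda>p q. cls scale (scal (eps p) q)"])
         (simp add: E sym_alg_smult,
          rule clin_comp[OF clin_cls klin_eps[OF klin_id]],
          rule clin_comp[OF clin_cls klin_scale[OF klin_id]])
    show "E (cls scale (basis m)) \<odot>\<^bsub>?S\<^esub> cls scale (basis n) = cls scale (counit_left (basis (m, n)))" for m n
      unfolding E sym_alg_smult tens_basis[symmetric] counit_left_tens ..
  qed
  moreover have "sweedler ?S (\<lambda>y z. E z \<odot>\<^bsub>?S\<^esub> y) (tcls scale a) = cls scale (counit_right a)" for a
  proof (rule sweedler_tcls[OF kmod_sym_alg])
    show "clin ?S (\<lambda>a. cls scale (counit_right a))"
      by (rule clin_comp[OF clin_cls klin_counit(2)])
    show "bilinear_map ?S ?S ?S (\<lambda>y z. E z \<odot>\<^bsub>?S\<^esub> y)"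
      by (rule bilinear_map_clsI[where H = "\<lambda>p q. cls scale (scal (eps q) p)"])
         (simp add: E sym_alg_smult,
          rule clin_comp[OF clin_cls klin_scale[OF klin_id]],
          rule clin_comp[OF clin_cls klin_eps[OF klin_id]])
    show "E (cls scale (basis n)) \<odot>\<^bsub>?S\<^esub> cls scale (basis m) = cls scale (counit_right (basis (m, n)))" for m n
      unfolding E sym_alg_smult tens_basis[symmetric] counit_right_tens ..
  qed
  ultimately have counit: "\<exists>E\<in>alg_hom ?S (type_algebra (*)). \<forall>x\<in>carrier ?S.
      sweedler ?S (\<lambda>y z. E y \<odot>\<^bsub>?S\<^esub> z) (D x) = x \<and> sweedler ?S (\<lambda>y z. E z \<odot>\<^bsub>?S\<^esub> y) (D x) = x"
    by (intro bexI[of _ E]) (auto simp: sym_alg_carrier D coprod_counit)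
  show ?thesis
    unfolding bialgebra_def
  proof (intro conjI ballI counit algebra_sym_alg)
    show "D \<in> alg_hom ?S ?T"
      using assms by (simp add: sym_coproduct_def Let_def)
    fix x assume "x \<in> carrier ?S"
    then obtain p where x: "x = cls scale p" by (auto simp: sym_alg_carrier)
    show "sweedler ?T3 (\<lambda>y z. sweedler ?T3 (\<lambda>u v. pure_tensor ?S ?T u (pure_tensor ?S ?S v z)) (D y)) (D x) =
        sweedler ?T3 (\<lambda>y z. pure_tensor ?S ?T y (D z)) (D x)"
      unfolding x D[of p] left right coprod_coassoc ..
  qed
qed

text \<open>
  The two Sweedler sums are the images of the two summands of \<open>coprod_bullet\<close>.
\<close>

lemma coproduct_bullet_sym_alg:
  assumes "sym_coproduct scale D" "sym_bullet scale f l b"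
    and "x \<in> carrier (sym_alg scale)" "y \<in> carrier (sym_alg scale)"
  shows "D (b x y) =
    sweedler (sym_tensor scale) (\<lambda>a1 a2. pure_tensor (sym_alg scale) (sym_alg scale) a1 (b a2 y)) (D x)
    \<oplus>\<^bsub>sym_tensor scale\<^esub>
    sweedler (sym_tensor scale)
      (\<lambda>a1 a2. sweedler (sym_tensor scale)
        (\<lambda>b1 b2. pure_tensor (sym_alg scale) (sym_alg scale) (b a1 b1) (a2 \<otimes>\<^bsub>sym_alg scale\<^esub> b2)) (D y))
      (D x)"
proof -
  let ?S = "sym_alg scale"
  let ?T = "sym_tensor scale"
  have D: "D (cls scale p) = tcls scale (coprod p)" for p
    using assms by (simp add: sym_coproduct_iff)
  have b: "b (cls scale p) (cls scale q) = cls scale (bullet l f p q)" for p q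
    using assms by (simp add: sym_bullet_iff)
  obtain p q where x: "x = cls scale p" and y: "y = cls scale q"
    using assms(3,4) by (auto simp: sym_alg_carrier)
  note ct = clin_comp[OF clin_tcls, of _ scale]
  let ?t = "tmap (trunc_resolvent l f) (\<lambda>r. r)"
  have first: "sweedler ?T (\<lambda>a1 a2. pure_tensor ?S ?S a1 (b a2 y)) (tcls scale a) =
      tcls scale (tmap (\<lambda>r. r) (\<lambda>r. bullet l f r q) a)" for a
  proof (rule sweedler_tcls[OF kmod_tensor])
    show "clin ?T (\<lambda>a. tcls scale (tmap (\<lambda>r. r) (\<lambda>r. bullet l f r q) a))"
      by (rule ct[OF klin_tmap])
    show "bilinear_map ?S ?S ?T (\<lambda>a1 a2. pure_tensor ?S ?S a1 (b a2 y))"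
      by (rule bilinear_map_clsI[where H = "\<lambda>p p'. tcls scale (tens p (bullet l f p' q))"])
         (simp add: y b pure_cls,
          rule ct[OF klin_tens_left],
          rule ct[OF klin_comp[OF klin_tens_right klin_bullet_left]])
    show "pure_tensor ?S ?S (cls scale (basis m)) (b (cls scale (basis n)) y) =
        tcls scale (tmap (\<lambda>r. r) (\<lambda>r. bullet l f r q) (basis (m, n)))" for m n
      unfolding y b pure_cls tmap_basis ..
  qed
  have inner: "sweedler ?T (\<lambda>b1 b2. pure_tensor ?S ?S (b (cls scale r) b1) (cls scale s \<otimes>\<^bsub>?S\<^esub> b2)) (D y) =
      tcls scale (tens (deriv f r) s * ?t (coprod q))" for r s
    unfolding y D
  proof (rule sweedler_tcls[OF kmod_tensor])
    show "clin ?T (\<lambda>a. tcls scale (tens (deriv f r) s * ?t a))"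
      by (rule ct[OF klin_mult_right[OF klin_tmap]])
    show "bilinear_map ?S ?S ?T (\<lambda>b1 b2. pure_tensor ?S ?S (b (cls scale r) b1) (cls scale s \<otimes>\<^bsub>?S\<^esub> b2))"
      by (rule bilinear_map_clsI[where H = "\<lambda>p p'. tcls scale (tens (bullet l f r p) (s * p'))"])
         (simp add: b sym_alg_mult pure_cls,
          rule ct[OF klin_comp[OF klin_tens_left klin_bullet_right]],
          rule ct[OF klin_comp[OF klin_tens_right klin_mult_right[OF klin_id]]])
    show "pure_tensor ?S ?S (b (cls scale r) (cls scale (basis m))) (cls scale s \<otimes>\<^bsub>?S\<^esub> cls scale (basis n)) =
        tcls scale (tens (deriv f r) s * ?t (basis (m, n)))" for m n
      unfolding b sym_alg_mult pure_cls tmap_basis tens_mult bullet_def ..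
  qed
  have second: "sweedler ?T (\<lambda>a1 a2. sweedler ?T (\<lambda>b1 b2. pure_tensor ?S ?S (b a1 b1) (a2 \<otimes>\<^bsub>?S\<^esub> b2)) (D y)) (tcls scale a) =
      tcls scale (tmap (deriv f) (\<lambda>r. r) a * ?t (coprod q))" for a
  proof (rule sweedler_tcls[OF kmod_tensor])
    show "clin ?T (\<lambda>a. tcls scale (tmap (deriv f) (\<lambda>r. r) a * ?t (coprod q)))"
      by (rule ct[OF klin_mult_left[OF klin_tmap]])
    show "bilinear_map ?S ?S ?T (\<lambda>a1 a2. sweedler ?T (\<lambda>b1 b2. pure_tensor ?S ?S (b a1 b1) (a2 \<otimes>\<^bsub>?S\<^esub> b2)) (D y))"
      by (rule bilinear_map_clsI[where H = "\<lambda>r s. tcls scale (tens (deriv f r) s * ?t (coprod q))"])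
         (rule inner,
          rule ct[OF klin_mult_left[OF klin_comp[OF klin_tens_left klin_deriv]]],
          rule ct[OF klin_mult_left[OF klin_tens_right]])
    show "sweedler ?T (\<lambda>b1 b2. pure_tensor ?S ?S (b (cls scale (basis m)) b1) (cls scale (basis n) \<otimes>\<^bsub>?S\<^esub> b2)) (D y) =
        tcls scale (tmap (deriv f) (\<lambda>r. r) (basis (m, n)) * ?t (coprod q))" for m n
      unfolding inner tmap_basis ..
  qed
  show ?thesis
    unfolding x D[of p] first second
    unfolding y b D coprod_bullet clin_add[OF clin_tcls] ..
qed

theorem theorem2p1:
  fixes scale :: "'k::field_char_0 \<Rightarrow> 'v::ab_group_add \<Rightarrow> 'v"
    and f :: "'v \<Rightarrow> 'k"
    and lam :: "'k"
  assumes "vector_space scale"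
    and "Vector_Spaces.linear scale (*) f"
  shows "(\<exists>Delta. sym_coproduct scale Delta) \<and>
    (\<forall>Delta Delta'. sym_coproduct scale Delta \<longrightarrow> sym_coproduct scale Delta' \<longrightarrow>
       (\<forall>a\<in>carrier (sym_alg scale). Delta a = Delta' a)) \<and>
    (\<exists>bul. sym_bullet scale f lam bul) \<and>
    (\<forall>bul bul'. sym_bullet scale f lam bul \<longrightarrow> sym_bullet scale f lam bul' \<longrightarrow>
       (\<forall>a\<in>carrier (sym_alg scale). \<forall>b\<in>carrier (sym_alg scale). bul a b = bul' a b)) \<and>
    (\<forall>Delta bul. sym_coproduct scale Delta \<longrightarrow> sym_bullet scale f lam bul \<longrightarrow>
       com_prelie_bialgebra (sym_alg scale) bul Delta)"
proof (intro conjI allI impI ballI)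
  show "\<exists>Delta. sym_coproduct scale Delta"
    by (rule ex_sym_coproduct)
  show "\<exists>bul. sym_bullet scale f lam bul"
    by (rule ex_sym_bullet[OF assms(2)])
next
  fix Delta Delta' a
  assume "sym_coproduct scale Delta" "sym_coproduct scale Delta'" "a \<in> carrier (sym_alg scale)"
  then show "Delta a = Delta' a"
    by (auto simp: sym_coproduct_iff sym_alg_carrier)
next
  fix bul bul' a b
  assume "sym_bullet scale f lam bul" "sym_bullet scale f lam bul'"
    "a \<in> carrier (sym_alg scale)" "b \<in> carrier (sym_alg scale)"
  then show "bul a b = bul' a b"
    by (auto simp: sym_bullet_iff sym_alg_carrier)
next
  fix Delta bul
  assume "sym_coproduct scale Delta" "sym_bullet scale f lam bul"
  then show "com_prelie_bialgebra (sym_alg scale) bul Delta"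
    unfolding com_prelie_bialgebra_def
    by (intro conjI ballI com_prelie_algebra_sym_alg bialgebra_sym_alg coproduct_bullet_sym_alg)
qed

end
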